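(* Let $A$ be a symmetrizable $I\times I$ Cartan matrix, $n=|I|$, let $\mathbf i_0=(i_1,\ldots,i_n)$ be any ordering of $I$, and assume $\mathbf i=(\mathbf i_0,\mathbf i_0)$ is reduced. Then for each $i=1,\ldots,n$ there exists an element $\tilde X_i\in U_+^*=\mathbb C_q[N]$ such that $\Psi_{\mathbf i}(\tilde X_i)=X_iC$, where $C$ is a monomial in $C_1,\ldots,C_n$.
   Context: $\Bbbk$ is a field of characteristic $0$, the base field is $\Bbbk(q^{1/2})$. $A=(a_{ij})$ is a generalized Cartan matrix, $d_i\in\mathbb Z_{>0}$ with $c_{ij}:=d_ia_{ij}=c_{ji}$, $q_i=q^{d_i}$. $U_+^*$ (the quantum coordinate algebra $\mathbb C_q[N]$) is the algebra generated by $x_i$, $i\in I$, with quantum Serre relations $\sum_{k=0}^{1-a_{ij}}(-1)^kx_i^{[k]}x_jx_i^{[1-a_{ij}-k]}=0$ ($i\ne j$), where $x_i^{[k]}=x_i^k/[k]_{q_i}!$, $[k]_{q_i}=\frac{q_i^k-q_i^{-k}}{q_i-q_i^{-1}}$. Write $m=2n$, $\mathbf i=(i_1,\ldots,i_m)$. $\mathcal L_{\mathbf i}$ is generated by $t_1^{\pm1},\ldots,t_m^{\pm1}$ with $t_\ell t_k=q^{c_{i_k,i_\ell}}t_kt_\ell$ for $k<\ell$, and $t^{\mathbf a}=q^{\frac12\sum_{k<\ell}c_{i_k,i_\ell}a_ka_\ell}t_1^{a_1}\cdots t_m^{a_m}$ for $\mathbf a\in\mathbb Z^m$. $\Psi_{\mathbf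 i}:U_+^*\to\mathcal L_{\mathbf i}$ is the algebra homomorphism $x_j\mapsto\sum_{k:i_k=j}t_k$. Reduced: $s_{i_1}\cdots s_{i_m}$ has length $m$ in the Weyl group of $A$. $k^+=\min(\{\ell>k:i_\ell=i_k\}\cup\{m+1\})$, $k^-=\max(\{\ell<k:i_\ell=i_k\}\cup\{0\})$; $\varphi_{\mathbf i}$ is the automorphism of $\mathbb Z^m$ with $\varphi_{\mathbf i}(\varepsilon_k)=-\varepsilon_k-\varepsilon_{k^-}-\sum_{\ell<k<\ell^+}a_{i_\ell,i_k}\varepsilon_\ell$ ($\varepsilon_1,\ldots,\varepsilon_m$ the standard basis, $\varepsilon_s=0$ for $s\notin[1,m]$). The initial cluster variables are $X_i=t^{\varphi_{\mathbf i}^{-1}(\varepsilon_i)}$, $i=1,\ldots,n$, and the coefficients are $C_i=t^{-\varphi_{\mathbf i}^{-1}(\varepsilon_{n+i})}$, $i=1,\ldots,n$. *)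

theory Defs
  imports
    "HOL-Algebra.QuotRing"
    "HOL-Library.Poly_Mapping"
    "HOL-Computational_Algebra.Polynomial_Factorial"
    "HOL-Library.FuncSet"
begin

text \<open>The field of rational functions in \<open>q\<^sup>1\<^sup>/\<^sup>2\<close> over a field \<open>'k\<close>;
  \<open>qhalf\<close> is the indeterminate \<open>q\<^sup>1\<^sup>/\<^sup>2\<close>.\<close>

type_synonym 'k qfield = "'k poly fract"

definition qhalf :: "('k::field_char_0) qfield" where
  "qhalf = to_fract [:0, 1:]"

definition qpar :: "('k::field_char_0) qfield" where
  "qpar = qhalf ^ 2"

definition qint :: "'a::field \<Rightarrow> nat \<Rightarrow> 'a" where
  "qint v k = (v powi int k - v powi (- int k)) / (v - v powi (- 1))"

definition qfact :: "'a::field \<Rightarrow> nat \<Rightarrow> 'a" where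
  "qfact v k = (\<Prod>r=1..k. qint v r)"

datatype 'g word = Word (letters: "'g list")

instantiation word :: (type) monoid_add
begin
definition zero_word :: "'g word" where "zero_word = Word []"
definition plus_word :: "'g word \<Rightarrow> 'g word \<Rightarrow> 'g word" where
  "plus_word u v = Word (letters u @ letters v)"
instance by standard (auto simp: zero_word_def plus_word_def)
end

text \<open>Noncommutative polynomials in letters from \<open>'g\<close>: finitely supported functions on the
  free monoid, multiplied by convolution.\<close>

type_synonym ('g, 'a) ncpoly = "'g word \<Rightarrow>\<^sub>0 'a"

definition Var :: "'g \<Rightarrow> ('g, 'a::field) ncpoly" where
  "Var g = Poly_Mapping.single (Word [g]) 1"

definition Const :: "'a \<Rightarrow> ('g, 'a::field) ncpoly" where
  "Const c = Poly_Mapping.single 0 c"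

definition free_alg :: "'g set \<Rightarrow> ('g, 'a::field) ncpoly ring" where
  "free_alg G = \<lparr>
     carrier = {f. \<forall>w \<in> Poly_Mapping.keys f. set (letters w) \<subseteq> G},
     monoid.mult = (*), one = 1, ring.zero = 0, add = (+)\<rparr>"

text \<open>An ideal of \<open>free_alg G\<close> is two-sided and, since scalars lie in \<open>free_alg G\<close>, a linear subspace.\<close>

definition presented_alg :: "'g set \<Rightarrow> ('g, 'a::field) ncpoly set \<Rightarrow> ('g, 'a) ncpoly set ring" where
  "presented_alg G rels = free_alg G Quot (Idl\<^bsub>free_alg G\<^esub> rels)"

definition pclass :: "'g set \<Rightarrow> ('g, 'a::field) ncpoly set \<Rightarrow> ('g, 'a) ncpoly \<Rightarrow> ('g, 'a) ncpoly set" where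
  "pclass G rels f = (Idl\<^bsub>free_alg G\<^esub> rels) +>\<^bsub>free_alg G\<^esub> f"

definition symmetrizable_cartan :: "'i set \<Rightarrow> ('i \<Rightarrow> 'i \<Rightarrow> int) \<Rightarrow> ('i \<Rightarrow> nat) \<Rightarrow> bool" where
  "symmetrizable_cartan I A d \<longleftrightarrow>
     finite I \<and>
     (\<forall>i\<in>I. A i i = 2) \<and>
     (\<forall>i\<in>I. \<forall>j\<in>I. i \<noteq> j \<longrightarrow> A i j \<le> 0) \<and>
     (\<forall>i\<in>I. \<forall>j\<in>I. A i j = 0 \<longleftrightarrow> A j i = 0) \<and>
     (\<forall>i\<in>I. d i > 0) \<and>
     (\<forall>i\<in>I. \<forall>j\<in>I. int (d i) * A i j = int (d j) * A j i)"

definition csym :: "('i \<Rightarrow> 'i \<Rightarrow> int) \<Rightarrow> ('i \<Rightarrow> nat) \<Rightarrow> 'i \<Rightarrow> 'i \<Rightarrow> int" where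
  "csym A d i j = int (d i) * A i j"

text \<open>The Weyl group is realised by its (faithful) action on the root lattice, a lattice vector
  being given by its coefficients \<open>v j\<close> at the simple roots \<open>\<alpha>\<^sub>j\<close>; thus
  \<open>s\<^sub>i(\<alpha>\<^sub>j) = \<alpha>\<^sub>j - a\<^sub>i\<^sub>j \<alpha>\<^sub>i\<close>.\<close>

definition simple_refl :: "'i set \<Rightarrow> ('i \<Rightarrow> 'i \<Rightarrow> int) \<Rightarrow> 'i \<Rightarrow> ('i \<Rightarrow> int) \<Rightarrow> ('i \<Rightarrow> int)" where
  "simple_refl I A i v = v(i := v i - (\<Sum>j\<in>I. A i j * v j))"

definition weyl_prod :: "'i set \<Rightarrow> ('i \<Rightarrow> 'i \<Rightarrow> int) \<Rightarrow> 'i list \<Rightarrow> ('i \<Rightarrow> int) \<Rightarrow> ('i \<Rightarrow> int)" where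
  "weyl_prod I A is = foldr (\<circ>) (map (simple_refl I A) is) id"

definition weyl_length :: "'i set \<Rightarrow> ('i \<Rightarrow> 'i \<Rightarrow> int) \<Rightarrow> (('i \<Rightarrow> int) \<Rightarrow> ('i \<Rightarrow> int)) \<Rightarrow> nat" where
  "weyl_length I A w = (LEAST k. \<exists>js. set js \<subseteq> I \<and> length js = k \<and> weyl_prod I A js = w)"

definition reduced_word :: "'i set \<Rightarrow> ('i \<Rightarrow> 'i \<Rightarrow> int) \<Rightarrow> 'i list \<Rightarrow> bool" where
  "reduced_word I A is \<longleftrightarrow> set is \<subseteq> I \<and> weyl_length I A (weyl_prod I A is) = length is"

definition divpow :: "('i \<Rightarrow> nat) \<Rightarrow> 'i \<Rightarrow> nat \<Rightarrow> ('i, ('k::field_char_0) qfield) ncpoly" where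
  "divpow d i k = Const (inverse (qfact (qpar ^ d i) k)) * Var i ^ k"

definition serre :: "('i \<Rightarrow> 'i \<Rightarrow> int) \<Rightarrow> ('i \<Rightarrow> nat) \<Rightarrow> 'i \<Rightarrow> 'i \<Rightarrow> ('i, ('k::field_char_0) qfield) ncpoly" where
  "serre A d i j =
     (let N = nat (1 - A i j)
      in \<Sum>k=0..N. (- 1) ^ k * divpow d i k * Var j * divpow d i (N - k))"

definition serre_rels :: "'i set \<Rightarrow> ('i \<Rightarrow> 'i \<Rightarrow> int) \<Rightarrow> ('i \<Rightarrow> nat) \<Rightarrow> ('i, ('k::field_char_0) qfield) ncpoly set" where
  "serre_rels I A d = {serre A d i j | i j. i \<in> I \<and> j \<in> I \<and> i \<noteq> j}"

definition Uplus :: "'i set \<Rightarrow> ('i \<Rightarrow> 'i \<Rightarrow> int) \<Rightarrow> ('i \<Rightarrow> nat) \<Rightarrow> ('i, ('k::field_char_0) qfield) ncpoly set ring" where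
  "Uplus I A d = presented_alg I (serre_rels I A d)"

definition Ux :: "'i set \<Rightarrow> ('i \<Rightarrow> 'i \<Rightarrow> int) \<Rightarrow> ('i \<Rightarrow> nat) \<Rightarrow> 'i \<Rightarrow> ('i, ('k::field_char_0) qfield) ncpoly set" where
  "Ux I A d j = pclass I (serre_rels I A d) (Var j)"

definition Uscalar :: "'i set \<Rightarrow> ('i \<Rightarrow> 'i \<Rightarrow> int) \<Rightarrow> ('i \<Rightarrow> nat) \<Rightarrow> 'k qfield \<Rightarrow> ('i, ('k::field_char_0) qfield) ncpoly set" where
  "Uscalar I A d c = pclass I (serre_rels I A d) (Const c)"

text \<open>Positions in a word are counted from 1.\<close>

definition letter :: "'i list \<Rightarrow> nat \<Rightarrow> 'i" where
  "letter is k = is ! (k - 1)"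

datatype tgen = T nat | Tinv nat

definition torus_gens :: "nat \<Rightarrow> tgen set" where
  "torus_gens m = T ` {1..m} \<union> Tinv ` {1..m}"

definition torus_rels :: "('i \<Rightarrow> 'i \<Rightarrow> int) \<Rightarrow> ('i \<Rightarrow> nat) \<Rightarrow> 'i list \<Rightarrow> (tgen, ('k::field_char_0) qfield) ncpoly set" where
  "torus_rels A d is =
     {Var (T k) * Var (Tinv k) - 1 | k. k \<in> {1..length is}} \<union>
     {Var (Tinv k) * Var (T k) - 1 | k. k \<in> {1..length is}} \<union>
     {Var (T l) * Var (T k)
        - Const (qpar powi csym A d (letter is k) (letter is l)) * Var (T k) * Var (T l)
      | k l. 1 \<le> k \<and> k < l \<and> l \<le> length is}"

definition torus :: "('i \<Rightarrow> 'i \<Rightarrow> int) \<Rightarrow> ('i \<Rightarrow> nat) \<Rightarrow> 'i list \<Rightarrow> (tgen, ('k::field_char_0) qfield) ncpoly set ring" where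
  "torus A d is = presented_alg (torus_gens (length is)) (torus_rels A d is)"

definition tclass :: "('i \<Rightarrow> 'i \<Rightarrow> int) \<Rightarrow> ('i \<Rightarrow> nat) \<Rightarrow> 'i list \<Rightarrow> (tgen, ('k::field_char_0) qfield) ncpoly \<Rightarrow> (tgen, 'k qfield) ncpoly set" where
  "tclass A d is f = pclass (torus_gens (length is)) (torus_rels A d is) f"

definition tpow :: "('i \<Rightarrow> 'i \<Rightarrow> int) \<Rightarrow> ('i \<Rightarrow> nat) \<Rightarrow> 'i list \<Rightarrow> nat \<Rightarrow> int \<Rightarrow> (tgen, ('k::field_char_0) qfield) ncpoly set" where
  "tpow A d is k a =
     (if a \<ge> 0 then tclass A d is (Var (T k)) [^]\<^bsub>torus A d is\<^esub> nat a
      else tclass A d is (Var (Tinv k)) [^]\<^bsub>torus A d is\<^esub> nat (- a))"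

text \<open>Ordered product \<open>f 1 \<cdot> f 2 \<cdots> f m\<close>.\<close>

definition oprod :: "('b, 'c) monoid_scheme \<Rightarrow> (nat \<Rightarrow> 'b) \<Rightarrow> nat \<Rightarrow> 'b" where
  "oprod M f m = foldr (\<lambda>k x. f k \<otimes>\<^bsub>M\<^esub> x) [1..<Suc m] \<one>\<^bsub>M\<^esub>"

text \<open>The normalised monomial \<open>t\<^sup>a\<close>. The exponent of \<open>qhalf\<close> absorbs the factor 1/2.\<close>

definition tmon :: "('i \<Rightarrow> 'i \<Rightarrow> int) \<Rightarrow> ('i \<Rightarrow> nat) \<Rightarrow> 'i list \<Rightarrow> (nat \<Rightarrow> int) \<Rightarrow> (tgen, ('k::field_char_0) qfield) ncpoly set" where
  "tmon A d is a =
     tclass A d is (Const (qhalf powi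
         (\<Sum>l=1..length is. \<Sum>k=1..<l. csym A d (letter is k) (letter is l) * a k * a l)))
     \<otimes>\<^bsub>torus A d is\<^esub> oprod (torus A d is) (\<lambda>k. tpow A d is k (a k)) (length is)"

text \<open>The linear ring homomorphism with prescribed values on generators is unique because the
  generators and scalars generate \<open>Uplus\<close>, and exists because the sums of the \<open>t\<^sub>k\<close> satisfy the
  quantum Serre relations.\<close>

definition Psi :: "'i set \<Rightarrow> ('i \<Rightarrow> 'i \<Rightarrow> int) \<Rightarrow> ('i \<Rightarrow> nat) \<Rightarrow> 'i list
    \<Rightarrow> ('i, ('k::field_char_0) qfield) ncpoly set \<Rightarrow> (tgen, 'k qfield) ncpoly set" where
  "Psi I A d is = (THE h.
     h \<in> extensional (carrier (Uplus I A d)) \<and>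
     h \<in> ring_hom (Uplus I A d) (torus A d is) \<and>
     (\<forall>c. h (Uscalar I A d c) = tclass A d is (Const c)) \<and>
     (\<forall>j\<in>I. h (Ux I A d j) =
        (\<Oplus>\<^bsub>torus A d is\<^esub>k\<in>{k \<in> {1..length is}. letter is k = j}. tclass A d is (Var (T k)))))"

definition zlattice :: "nat \<Rightarrow> (nat \<Rightarrow> int) set" where
  "zlattice m = {a. \<forall>k. k \<notin> {1..m} \<longrightarrow> a k = 0}"

definition eps :: "nat \<Rightarrow> nat \<Rightarrow> nat \<Rightarrow> int" where
  "eps m s = (\<lambda>p. if s \<in> {1..m} \<and> p = s then 1 else 0)"

definition next_pos :: "'i list \<Rightarrow> nat \<Rightarrow> nat" where
  "next_pos is k = Min ({l \<in> {1..length is}. l > k \<and> letter is l = letter is k} \<union> {length is + 1})"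

definition prev_pos :: "'i list \<Rightarrow> nat \<Rightarrow> nat" where
  "prev_pos is k = Max ({l \<in> {1..length is}. l < k \<and> letter is l = letter is k} \<union> {0})"

text \<open>\<open>phi_basis A is k\<close> is the image of the \<open>k\<close>-th standard basis vector. The coefficient at
  position \<open>k\<close> is \<open>-1\<close> and those at later positions vanish, so \<open>phi\<close> is a bijection of \<open>zlattice\<close>.\<close>

definition phi_basis :: "('i \<Rightarrow> 'i \<Rightarrow> int) \<Rightarrow> 'i list \<Rightarrow> nat \<Rightarrow> nat \<Rightarrow> int" where
  "phi_basis A is k = (\<lambda>p.
     - eps (length is) k p - eps (length is) (prev_pos is k) p
     - (\<Sum>l \<in> {l \<in> {1..length is}. l < k \<and> k < next_pos is l}.
          A (letter is l) (letter is k) * eps (length is) l p))"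

definition phi :: "('i \<Rightarrow> 'i \<Rightarrow> int) \<Rightarrow> 'i list \<Rightarrow> (nat \<Rightarrow> int) \<Rightarrow> (nat \<Rightarrow> int)" where
  "phi A is a = (\<lambda>p. \<Sum>k=1..length is. a k * phi_basis A is k p)"

definition phi_inv :: "('i \<Rightarrow> 'i \<Rightarrow> int) \<Rightarrow> 'i list \<Rightarrow> (nat \<Rightarrow> int) \<Rightarrow> (nat \<Rightarrow> int)" where
  "phi_inv A is = inv_into (zlattice (length is)) (phi A is)"

definition cluster_X :: "('i \<Rightarrow> 'i \<Rightarrow> int) \<Rightarrow> ('i \<Rightarrow> nat) \<Rightarrow> 'i list \<Rightarrow> nat \<Rightarrow> (tgen, ('k::field_char_0) qfield) ncpoly set" where
  "cluster_X A d is i = tmon A d is (phi_inv A is (eps (length is) i))"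

definition cluster_C :: "('i \<Rightarrow> 'i \<Rightarrow> int) \<Rightarrow> ('i \<Rightarrow> nat) \<Rightarrow> 'i list \<Rightarrow> nat \<Rightarrow> nat \<Rightarrow> (tgen, ('k::field_char_0) qfield) ncpoly set" where
  "cluster_C A d is n i = tmon A d is (\<lambda>p. - phi_inv A is (eps (length is) (n + i)) p)"

end

theory Submission
  imports Defs
begin

text \<open>Every \<open>x\<^sub>k\<close> is sent to \<open>t\<^sub>k + t\<^sub>n\<^sub>+\<^sub>k\<close>, so a \<open>q\<close>-commutator of \<open>x\<^sub>k\<close> with a monomial \<open>t\<^sup>a\<close> of the
  image can be tuned to cancel one of the two resulting monomials: if \<open>t\<^sub>k\<close> and \<open>t\<^sub>n\<^sub>+\<^sub>k\<close> commute
  differently with \<open>t\<^sup>a\<close>, then \<open>t\<^sup>a t\<^sub>k\<close> and \<open>t\<^sup>a t\<^sub>n\<^sub>+\<^sub>k\<close> lie in the image as well. The discrepancy of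
  the two commutation factors is \<open>- 2 d\<^sub>k \<phi>(a)\<^sub>k\<close>, and the monomials \<open>X\<^sub>i C\<close> are exactly those with
  \<open>\<phi>(a)\<^sub>k = \<delta>\<^sub>i\<^sub>k\<close> and \<open>\<phi>(a)\<^sub>n\<^sub>+\<^sub>k \<le> 0\<close> for \<open>k \<le> n\<close>. Start from \<open>t\<^sub>j t\<^sub>n\<^sub>+\<^sub>k\<close>, a \<open>q\<close>-commutator of
  \<open>x\<^sub>j\<close> and \<open>x\<^sub>k\<close> for adjacent \<open>k < j\<close>; here all \<open>\<phi>(a)\<^sub>l \<ge> 0\<close> for \<open>l \<le> n\<close>. Steps of the above kind carry
  a positive entry of \<open>\<phi>(a)\<close> along the Dynkin diagram to position \<open>i\<close>; multiplying with further
  starting monomials repairs the entries \<open>\<phi>(a)\<^sub>n\<^sub>+\<^sub>k\<close>, and finally the first \<open>n\<close> entries are lowered to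
  \<open>\<delta>\<^sub>i\<close>, from the last to the first. This only fails if no positive entry is available in the
  component of \<open>i\<close>, which forces it to be of type \<open>A\<^sub>r\<close> with linear orientation; there the square
  of the Coxeter element has length less than \<open>2 r\<close>, so the word is not reduced.\<close>

section \<open>The free algebra and its quotients\<close>

lemma carrier_free_alg: "f \<in> carrier (free_alg G) \<longleftrightarrow> (\<forall>w \<in> Poly_Mapping.keys f. set (letters w) \<subseteq> G)"
  by (simp add: free_alg_def)

lemma free_alg_simps [simp]:
  "monoid.mult (free_alg G) = (*)" "monoid.one (free_alg G) = 1"
  "ring.zero (free_alg G) = 0" "ring.add (free_alg G) = (+)"
  by (simp_all add: free_alg_def)

lemma letters_zero [simp]: "letters 0 = []"
  by (simp add: zero_word_def)

lemma letters_plus [simp]: "letters (u + v) = letters u @ letters v"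
  by (simp add: plus_word_def)

lemma free_alg_zero: "0 \<in> carrier (free_alg G)"
  and free_alg_one: "1 \<in> carrier (free_alg G)"
  by (auto simp: carrier_free_alg)

lemma free_alg_add: "f \<in> carrier (free_alg G) \<Longrightarrow> g \<in> carrier (free_alg G) \<Longrightarrow> f + g \<in> carrier (free_alg G)"
  using Poly_Mapping.keys_add[of f g] by (auto simp: carrier_free_alg)

lemma free_alg_uminus: "f \<in> carrier (free_alg G) \<Longrightarrow> - f \<in> carrier (free_alg G)"
  by (simp add: carrier_free_alg)

lemma free_alg_diff: "f \<in> carrier (free_alg G) \<Longrightarrow> g \<in> carrier (free_alg G) \<Longrightarrow> f - g \<in> carrier (free_alg G)"
  using free_alg_add[of f G "- g"] free_alg_uminus[of g G] by simp

lemma free_alg_mult: "f \<in> carrier (free_alg G) \<Longrightarrow> g \<in> carrier (free_alg G) \<Longrightarrow> f * g \<in> carrier (free_alg G)"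
  using Poly_Mapping.keys_mult[of f g] by (fastforce simp: carrier_free_alg)

lemma free_alg_power: "f \<in> carrier (free_alg G) \<Longrightarrow> f ^ n \<in> carrier (free_alg G)"
  by (induction n) (auto intro: free_alg_mult free_alg_one)

lemma free_alg_sum: "(\<And>i. i \<in> S \<Longrightarrow> f i \<in> carrier (free_alg G)) \<Longrightarrow> sum f S \<in> carrier (free_alg G)"
  by (induction S rule: infinite_finite_induct) (auto intro: free_alg_add free_alg_zero)

lemma free_alg_prod_list: "(\<And>f. f \<in> set fs \<Longrightarrow> f \<in> carrier (free_alg G)) \<Longrightarrow> prod_list fs \<in> carrier (free_alg G)"
  by (induction fs) (auto intro: free_alg_mult free_alg_one)

lemma free_alg_Const: "Const c \<in> carrier (free_alg G)"
  by (auto simp: carrier_free_alg Const_def)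

lemma free_alg_Var: "g \<in> G \<Longrightarrow> Var g \<in> carrier (free_alg G)"
  by (auto simp: carrier_free_alg Var_def)

lemmas free_alg_intros = free_alg_zero free_alg_one free_alg_add free_alg_uminus free_alg_diff
  free_alg_mult free_alg_power free_alg_sum free_alg_prod_list free_alg_Const free_alg_Var

lemma ring_free_alg: "ring (free_alg G)"
proof (rule ringI)
  show "abelian_group (free_alg G)"
  proof (rule abelian_groupI)
    fix x assume "x \<in> carrier (free_alg G)"
    then show "\<exists>y\<in>carrier (free_alg G). y \<oplus>\<^bsub>free_alg G\<^esub> x = \<zero>\<^bsub>free_alg G\<^esub>"
      using free_alg_uminus[of x G] by (intro bexI[of _ "- x"]) auto
  qed (auto intro: free_alg_intros)
  show "monoid (free_alg G)"
    by (rule monoidI) (auto intro: free_alg_intros simp: mult.assoc)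
qed (auto simp: algebra_simps)

lemma a_inv_free_alg: "f \<in> carrier (free_alg G) \<Longrightarrow> \<ominus>\<^bsub>free_alg G\<^esub> f = - f"
proof -
  interpret ring "free_alg G" by (rule ring_free_alg)
  assume "f \<in> carrier (free_alg G)"
  then show ?thesis
    using minus_equality[of "- f" f] free_alg_uminus[of f G] by simp
qed

lemma a_minus_free_alg:
  "f \<in> carrier (free_alg G) \<Longrightarrow> g \<in> carrier (free_alg G) \<Longrightarrow> f \<ominus>\<^bsub>free_alg G\<^esub> g = f - g"
  by (simp add: a_minus_def a_inv_free_alg)

lemma Const_0 [simp]: "Const 0 = 0"
  and Const_1 [simp]: "Const 1 = 1"
  and Const_add: "Const (c + c') = Const c + Const c'"
  and Const_diff: "Const (c - c') = Const c - Const c'"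
  and Const_uminus: "Const (- c) = - Const c"
  and Const_mult: "Const (c * c') = Const c * Const c'"
  by (simp_all add: Const_def single_add single_diff single_uminus mult_single)

lemma single_eq_Const_mult: "Poly_Mapping.single w c = Const c * Poly_Mapping.single w 1"
  by (simp add: Const_def mult_single)

lemma ncpoly_induct [case_names single add]:
  assumes single: "\<And>w c. P (Poly_Mapping.single w c)"
    and add: "\<And>f g. P f \<Longrightarrow> P g \<Longrightarrow> P (f + g)"
  shows "P (f :: ('g, 'a::field) ncpoly)"
proof (induction f rule: update_induct)
  case const
  show ?case using single[of 0 0] by simp
next
  case (update f k v)
  have "Poly_Mapping.update k v f = f + Poly_Mapping.single k v"
    using update(1)
    by (intro poly_mapping_eqI) (auto simp: lookup_update lookup_add lookup_single not_in_keys_iff_lookup_eq_zero when_def)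
  then show ?case using add[OF update(3) single] by simp
qed

lemma Const_commute: "f * Const c = Const c * f"
  by (induction f rule: ncpoly_induct) (simp_all add: Const_def mult_single algebra_simps)

lemma Const_left_commute: "f * (Const c * g) = Const c * (f * g)"
  by (simp only: Const_commute flip: mult.assoc)

section \<open>Substitution homomorphisms between free algebras\<close>

definition subst :: "('g \<Rightarrow> ('h, 'a::field) ncpoly) \<Rightarrow> ('g, 'a) ncpoly \<Rightarrow> ('h, 'a) ncpoly" where
  "subst s f = (\<Sum>w\<in>Poly_Mapping.keys f. Const (Poly_Mapping.lookup f w) * prod_list (map s (letters w)))"

text \<open>Allows several polynomials to be expanded over one common finite set of words, which is
  how additivity of \<open>subst\<close> is obtained.\<close>

lemma subst_superset:
  assumes "finite W" "Poly_Mapping.keys f \<subseteq> W"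
  shows "subst s f = (\<Sum>w\<in>W. Const (Poly_Mapping.lookup f w) * prod_list (map s (letters w)))"
  unfolding subst_def using assms
  by (intro sum.mono_neutral_left) (auto simp: not_in_keys_iff_lookup_eq_zero)

lemma subst_single [simp]: "subst s (Poly_Mapping.single w c) = Const c * prod_list (map s (letters w))"
  by (subst subst_superset[of "{w}"]) (auto simp: lookup_single)

lemma subst_add [simp]: "subst s (f + g) = subst s f + subst s g"
proof -
  let ?W = "Poly_Mapping.keys f \<union> Poly_Mapping.keys g"
  have "Poly_Mapping.keys (f + g) \<subseteq> ?W" by (rule Poly_Mapping.keys_add)
  then show ?thesis
    by (simp add: subst_superset[of ?W] lookup_add Const_add distrib_right sum.distrib)
qed

lemma subst_0 [simp]: "subst s 0 = 0"
  by (simp add: subst_def)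

lemma subst_uminus [simp]: "subst s (- f) = - subst s f"
  by (rule minus_unique[symmetric]) (simp flip: subst_add)

lemma subst_diff [simp]: "subst s (f - g) = subst s f - subst s g"
  using subst_add[of s f "- g"] by simp

lemma subst_mult [simp]: "subst s (f * g) = subst s f * subst s g"
proof (induction f rule: ncpoly_induct)
  case (single w c)
  show ?case
  proof (induction g rule: ncpoly_induct)
    case (single v b)
    show ?case
      by (simp add: mult_single Const_mult mult.assoc Const_left_commute[of "prod_list (map s (letters w))"])
  qed (simp add: algebra_simps)
qed (simp add: algebra_simps)

lemma subst_Const [simp]: "subst s (Const c) = Const c"
  unfolding Const_def[of c] by (simp add: Const_def)

lemma subst_1 [simp]: "subst s 1 = 1"
  using subst_Const[of s 1] by simp

lemma subst_Var [simp]: "subst s (Var g) = s g"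
  by (simp add: Var_def)

lemma subst_power [simp]: "subst s (f ^ n) = subst s f ^ n"
  by (induction n) auto

lemma subst_sum [simp]: "subst s (sum f S) = (\<Sum>i\<in>S. subst s (f i))"
  by (induction S rule: infinite_finite_induct) auto

lemma subst_prod_list: "subst s (prod_list fs) = prod_list (map (subst s) fs)"
  by (induction fs) auto

lemma subst_in_free_alg: "(\<And>g. s g \<in> carrier (free_alg G)) \<Longrightarrow> subst s f \<in> carrier (free_alg G)"
  unfolding subst_def by (auto intro!: free_alg_intros)

lemma subst_cong_free_alg:
  assumes "f \<in> carrier (free_alg G)" "\<And>g. g \<in> G \<Longrightarrow> s g = s' g"
  shows "subst s f = subst s' f"
  unfolding subst_def using assms
  by (intro sum.cong refl arg_cong2[of _ _ _ _ "(*)"] arg_cong[of _ _ prod_list] map_cong)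
    (auto simp: carrier_free_alg)

lemma subst_id: "subst Var (f :: ('g, 'a::field) ncpoly) = f"
proof (induction f rule: ncpoly_induct)
  case (single w c)
  have "prod_list (map Var ls) = (Poly_Mapping.single (Word ls) 1 :: ('g, 'a) ncpoly)" for ls :: "'g list"
  proof (induction ls)
    case Nil
    show ?case by (simp flip: zero_word_def)
  qed (simp add: Var_def mult_single plus_word_def)
  from this[of "letters w"] show ?case using single_eq_Const_mult[of w c] by simp
qed simp

lemma subst_comp: "subst s (subst s' f) = subst (\<lambda>g. subst s (s' g)) f"
  by (induction f rule: ncpoly_induct) (auto simp: subst_prod_list comp_def)

text \<open>Killing the letters outside \<open>G\<close> retracts the full algebra onto \<open>free_alg G\<close>. This allows us
  to compute in the ambient type, without carrier conditions.\<close>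

definition retract :: "'g set \<Rightarrow> ('g, 'a::field) ncpoly \<Rightarrow> ('g, 'a) ncpoly" where
  "retract G = subst (\<lambda>g. if g \<in> G then Var g else 0)"

lemma retract_in: "retract G f \<in> carrier (free_alg G)"
  unfolding retract_def by (rule subst_in_free_alg) (auto intro: free_alg_intros)

lemma retract_id: "f \<in> carrier (free_alg G) \<Longrightarrow> retract G f = f"
  using subst_cong_free_alg[of f G "\<lambda>g. if g \<in> G then Var g else 0" Var]
  by (simp add: retract_def subst_id)

lemma subst_retract: "(\<And>g. g \<notin> G \<Longrightarrow> s g = 0) \<Longrightarrow> subst s (retract G f) = subst s f"
  unfolding retract_def subst_comp by (rule arg_cong[of _ _ "\<lambda>s. subst s f"]) auto

section \<open>Two-sided ideals of the ambient ring\<close>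

text \<open>Counterpart of \<open>Idl\<close> without carrier conditions. Signs and scalars are
  absorbed by the cofactor \<open>a\<close>, so sums of terms \<open>a * r * b\<close>
  suffice.\<close>

inductive_set tideal :: "'r::ring_1 set \<Rightarrow> 'r set" for R where
  zero: "0 \<in> tideal R"
| gen: "r \<in> R \<Longrightarrow> a * r * b \<in> tideal R"
| add: "x \<in> tideal R \<Longrightarrow> y \<in> tideal R \<Longrightarrow> x + y \<in> tideal R"

lemma tideal_lmult: "x \<in> tideal R \<Longrightarrow> a * x \<in> tideal R"
  by (induction rule: tideal.induct)
    (auto intro: tideal.intros simp: distrib_left simp flip: mult.assoc)

lemma tideal_rmult: "x \<in> tideal R \<Longrightarrow> x * a \<in> tideal R"
proof (induction rule: tideal.induct)
  case (gen r a' b)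
  then show ?case using tideal.gen[of r R a' "b * a"] by (simp add: mult.assoc)
qed (auto intro: tideal.intros simp: distrib_right)

lemma tideal_uminus: "x \<in> tideal R \<Longrightarrow> - x \<in> tideal R"
  using tideal_lmult[of x R "- 1"] by simp

lemma tideal_base: "r \<in> R \<Longrightarrow> r \<in> tideal R"
  using tideal.gen[of r R 1 1] by simp

text \<open>The cofactors in \<open>a * r * b\<close> may contain letters outside \<open>G\<close>.
  Applying \<open>retract G\<close> fixes \<open>f\<close> and the relations and turns the cofactors
  into elements of \<open>free_alg G\<close>.\<close>

lemma tideal_in_Idl:
  assumes "R \<subseteq> carrier (free_alg G)" "f \<in> tideal R" "f \<in> carrier (free_alg G)"
  shows "f \<in> Idl\<^bsub>free_alg G\<^esub> R"
proof -
  interpret ring "free_alg G" by (rule ring_free_alg)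
  interpret J: ideal "Idl\<^bsub>free_alg G\<^esub> R" "free_alg G" using genideal_ideal assms(1) .
  have "retract G f \<in> Idl\<^bsub>free_alg G\<^esub> R" using assms(2)
  proof (induction rule: tideal.induct)
    case zero
    show ?case using J.zero_closed by (simp add: retract_def)
  next
    case (gen r a b)
    have "r \<in> Idl\<^bsub>free_alg G\<^esub> R" using genideal_self[OF assms(1)] gen by auto
    moreover have "retract G r = r" using gen assms(1) by (auto intro: retract_id)
    ultimately have "retract G a * r * retract G b \<in> Idl\<^bsub>free_alg G\<^esub> R"
      using J.I_l_closed[of r "retract G a"] J.I_r_closed[of "retract G a * r" "retract G b"]
      by (simp add: retract_in)
    then show ?case using \<open>retract G r = r\<close> by (simp add: retract_def)
  next
    case (add x y)
    then show ?case using J.a_closed by (simp add: retract_def)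
  qed
  then show ?thesis using assms(3) by (simp add: retract_id)
qed

text \<open>The preimage of an ideal under a homomorphism is an ideal; here it contains
  \<open>R\<close>, and \<open>Idl\<close> is the smallest such ideal.\<close>

lemma subst_Idl_in_tideal:
  fixes R :: "('g, 'a::field) ncpoly set"
  assumes "R \<subseteq> carrier (free_alg G)" "\<And>r. r \<in> R \<Longrightarrow> subst s r \<in> tideal R'"
    and "f \<in> Idl\<^bsub>free_alg G\<^esub> R"
  shows "subst s f \<in> tideal R'"
proof -
  interpret ring "free_alg G :: ('g, 'a) ncpoly ring" by (rule ring_free_alg)
  let ?K = "{f \<in> carrier (free_alg G). subst s f \<in> tideal R'}"
  have "ideal ?K (free_alg G)"
  proof (rule idealI)
    have uminus: "inv\<^bsub>add_monoid (free_alg G)\<^esub> x = - x" if "x \<in> carrier (free_alg G)"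
      for x :: "('g, 'a) ncpoly"
      using a_inv_free_alg[OF that] by (simp add: a_inv_def)
    show "subgroup ?K (add_monoid (free_alg G))"
    proof (rule group.subgroupI[OF a_group])
      show "?K \<noteq> {}" using free_alg_zero[of G] tideal.zero[of R'] by force
    next
      fix x assume "x \<in> ?K"
      then show "inv\<^bsub>add_monoid (free_alg G)\<^esub> x \<in> ?K"
        using uminus[of x] by (simp add: free_alg_uminus tideal_uminus del: free_alg_simps)
    next
      fix x y assume "x \<in> ?K" "y \<in> ?K"
      then show "x \<otimes>\<^bsub>add_monoid (free_alg G)\<^esub> y \<in> ?K"
        by (simp add: free_alg_add tideal.add)
    qed auto
    show "ring (free_alg G)" by (rule ring_free_alg)
  qed (simp_all add: free_alg_mult tideal_lmult tideal_rmult)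
  then have "Idl\<^bsub>free_alg G\<^esub> R \<subseteq> ?K"
    using assms(1,2) by (intro genideal_minimal) auto
  then show ?thesis using assms(3) by auto
qed

section \<open>Congruences modulo an ideal\<close>

locale ncpoly_congruence =
  fixes R :: "('g, 'a::field) ncpoly set"
begin

definition congr :: "('g, 'a) ncpoly \<Rightarrow> ('g, 'a) ncpoly \<Rightarrow> bool" (infix "\<approx>" 50) where
  "f \<approx> g \<longleftrightarrow> f - g \<in> tideal R"

lemma congr_refl [simp, intro]: "f \<approx> f"
  by (simp add: congr_def tideal.zero)

lemma congr_sym: "f \<approx> g \<Longrightarrow> g \<approx> f"
  using tideal_uminus[of "f - g" R] by (simp add: congr_def)

lemma congr_trans [trans]: "f \<approx> g \<Longrightarrow> g \<approx> h \<Longrightarrow> f \<approx> h"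
  using tideal.add[of "f - g" R "g - h"] by (simp add: congr_def)

lemma congr_add: "f \<approx> f' \<Longrightarrow> g \<approx> g' \<Longrightarrow> f + g \<approx> f' + g'"
  using tideal.add[of "f - f'" R "g - g'"] by (simp add: congr_def algebra_simps)

lemma congr_uminus: "f \<approx> f' \<Longrightarrow> - f \<approx> - f'"
  using tideal_uminus[of "f - f'" R] by (simp add: congr_def algebra_simps)

lemma congr_diff: "f \<approx> f' \<Longrightarrow> g \<approx> g' \<Longrightarrow> f - g \<approx> f' - g'"
  using congr_add[of f f' "- g" "- g'"] congr_uminus[of g g'] by simp

lemma congr_lmult: "f \<approx> f' \<Longrightarrow> a * f \<approx> a * f'"
  using tideal_lmult[of "f - f'" R a] by (simp add: congr_def algebra_simps)

lemma congr_rmult: "f \<approx> f' \<Longrightarrow> f * a \<approx> f' * a"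
  using tideal_rmult[of "f - f'" R a] by (simp add: congr_def algebra_simps)

lemma congr_mult: "f \<approx> f' \<Longrightarrow> g \<approx> g' \<Longrightarrow> f * g \<approx> f' * g'"
  by (blast intro: congr_trans congr_lmult congr_rmult)

lemma congr_sum: "(\<And>i. i \<in> S \<Longrightarrow> f i \<approx> g i) \<Longrightarrow> sum f S \<approx> sum g S"
  by (induction S rule: infinite_finite_induct) (auto intro: congr_add)

section \<open>Elements commuting up to a nonzero scalar\<close>

definition qcomm :: "'a \<Rightarrow> ('g, 'a) ncpoly \<Rightarrow> ('g, 'a) ncpoly \<Rightarrow> bool" where
  "qcomm c f g \<longleftrightarrow> c \<noteq> 0 \<and> f * g \<approx> Const c * (g * f)"

lemma qcommD: "qcomm c f g \<Longrightarrow> f * g \<approx> Const c * (g * f)"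
  by (simp add: qcomm_def)

lemma Const_mult_Const: "Const c * (Const c' * f) = Const (c * c') * (f :: ('g, 'a) ncpoly)"
  by (simp add: Const_mult mult.assoc)

lemma qcomm_sym:
  assumes "qcomm c f g"
  shows "qcomm (inverse c) g f"
proof -
  have "Const (inverse c) * (f * g) \<approx> Const (inverse c) * (Const c * (g * f))"
    using assms by (intro congr_lmult qcommD)
  also have "Const (inverse c) * (Const c * (g * f)) = g * f"
    using assms by (simp add: Const_mult_Const qcomm_def)
  finally show ?thesis using assms by (simp add: qcomm_def congr_sym)
qed

lemma qcomm_1 [simp]: "qcomm 1 f 1"
  by (simp add: qcomm_def)

lemma qcomm_refl: "qcomm 1 f f"
  by (simp add: qcomm_def)

lemma qcomm_mult_right:
  assumes "qcomm c f g" "qcomm c' f g'"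
  shows "qcomm (c * c') f (g * g')"
proof -
  have "f * (g * g') = f * g * g'" by (simp add: mult.assoc)
  also have "\<dots> \<approx> Const c * (g * f) * g'"
    using assms by (intro congr_rmult qcommD)
  also have "Const c * (g * f) * g' = Const c * g * (f * g')"
    by (simp add: mult.assoc)
  also have "\<dots> \<approx> Const c * g * (Const c' * (g' * f))"
    using assms by (intro congr_lmult qcommD)
  also have "\<dots> = Const (c * c') * (g * g' * f)"
    by (simp add: mult.assoc Const_left_commute[of g] Const_mult_Const)
  finally show ?thesis using assms by (auto simp: qcomm_def)
qed

lemma qcomm_power_right: "qcomm c f g \<Longrightarrow> qcomm (c ^ n) f (g ^ n)"
  by (induction n) (auto intro: qcomm_mult_right)

lemma qcomm_prod_list_right:
  assumes "\<And>k. k \<in> set ks \<Longrightarrow> qcomm (c k) f (g k)"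
  shows "qcomm (prod_list (map c ks)) f (prod_list (map g ks))"
  using assms by (induction ks) (auto intro: qcomm_mult_right)

lemma qcomm_sum_right:
  assumes "\<And>k. k \<in> S \<Longrightarrow> qcomm c f (g k)" "c \<noteq> 0"
  shows "qcomm c f (sum g S)"
  using assms congr_sum[of S "\<lambda>k. f * g k" "\<lambda>k. Const c * (g k * f)"]
  by (simp add: qcomm_def sum_distrib_left sum_distrib_right)

lemma qcomm_sum_left:
  assumes "\<And>k. k \<in> S \<Longrightarrow> qcomm c (f k) g" "c \<noteq> 0"
  shows "qcomm c (sum f S) g"
  using qcomm_sym[OF qcomm_sum_right[of S "inverse c" g f]] assms qcomm_sym by simp

text \<open>Insert \<open>g * g'\<close> to the right of \<open>g' * f\<close> and exchange
  \<open>f\<close> and \<open>g\<close> in the middle; then \<open>g' * g\<close> cancels.\<close>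

lemma qcomm_inverse_right:
  assumes "qcomm c f g" "g * g' \<approx> 1" "g' * g \<approx> 1"
  shows "qcomm (inverse c) f g'"
proof -
  have "g' * f = g' * f * 1" by simp
  also have "\<dots> \<approx> g' * f * (g * g')"
    by (rule congr_lmult[OF congr_sym[OF assms(2)]])
  also have "g' * f * (g * g') = g' * (f * g) * g'"
    by (simp add: mult.assoc)
  also have "\<dots> \<approx> g' * (Const c * (g * f)) * g'"
    using assms by (intro congr_rmult congr_lmult qcommD)
  also have "\<dots> = (g' * g) * (Const c * (f * g'))"
    by (simp add: mult.assoc Const_left_commute[of g'] Const_left_commute[of g])
  also have "\<dots> \<approx> 1 * (Const c * (f * g'))"
    using assms by (intro congr_rmult)
  finally have "qcomm c g' f" using assms by (simp add: qcomm_def)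
  then show ?thesis by (rule qcomm_sym)
qed

text \<open>The image of the homomorphism contains the scalars, so whether a monomial lies in it
  depends on the monomial only up to this relation. All powers of \<open>q\<close> caused by
  reordering are dropped through it.\<close>

definition scong :: "('g, 'a) ncpoly \<Rightarrow> ('g, 'a) ncpoly \<Rightarrow> bool" (infix "\<sim>" 50) where
  "f \<sim> g \<longleftrightarrow> (\<exists>c. c \<noteq> 0 \<and> f \<approx> Const c * g)"

lemma scong_of_congr: "f \<approx> g \<Longrightarrow> f \<sim> g"
  unfolding scong_def by (intro exI[of _ 1]) simp

lemma scong_of_qcomm: "qcomm c f g \<Longrightarrow> f * g \<sim> g * f"
  by (auto simp: scong_def qcomm_def)

lemma scong_refl [simp]: "f \<sim> f"
  by (simp add: scong_of_congr)

lemma scong_sym: assumes "f \<sim> g" shows "g \<sim> f"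
proof -
  obtain c where c: "c \<noteq> 0" "f \<approx> Const c * g" using assms by (auto simp: scong_def)
  then have "Const (inverse c) * (Const c * g) \<approx> Const (inverse c) * f"
    by (intro congr_lmult[OF congr_sym[OF c(2)]])
  then show ?thesis using c unfolding scong_def
    by (intro exI[of _ "inverse c"]) (simp add: Const_mult_Const)
qed

lemma scong_trans [trans]: assumes "f \<sim> g" "g \<sim> h" shows "f \<sim> h"
proof -
  obtain c c' where c: "c \<noteq> 0" "f \<approx> Const c * g" "c' \<noteq> 0" "g \<approx> Const c' * h"
    using assms by (auto simp: scong_def)
  have "f \<approx> Const c * (Const c' * h)"
    using congr_trans[OF c(2) congr_lmult[OF c(4)]] .
  then show ?thesis using c unfolding scong_def
    by (intro exI[of _ "c * c'"]) (simp add: Const_mult_Const)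
qed

lemma scong_mult: assumes "f \<sim> f'" "g \<sim> g'" shows "f * g \<sim> f' * g'"
proof -
  obtain c c' where c: "c \<noteq> 0" "f \<approx> Const c * f'" "c' \<noteq> 0" "g \<approx> Const c' * g'"
    using assms by (auto simp: scong_def)
  have "f * g \<approx> (Const c * f') * (Const c' * g')"
    using c by (intro congr_mult)
  also have "\<dots> = Const (c * c') * (f' * g')"
    by (simp add: mult.assoc Const_left_commute[of f'] Const_mult_Const)
  finally show ?thesis using c unfolding scong_def by (intro exI[of _ "c * c'"]) simp
qed

lemma scong_Const_mult: "c \<noteq> 0 \<Longrightarrow> Const c * f \<sim> f"
  by (auto simp: scong_def)

text \<open>Each \<open>g k\<close> is moved to the left through the factors coming after
  \<open>f k\<close>, at the cost of a scalar.\<close>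

lemma scong_prod_list_mult:
  assumes "\<And>k l. k \<in> set ks \<Longrightarrow> l \<in> set ks \<Longrightarrow> f k * g l \<sim> g l * f k"
  shows "prod_list (map f ks) * prod_list (map g ks) \<sim> prod_list (map (\<lambda>k. f k * g k) ks)"
  using assms
proof (induction ks)
  case (Cons k ks)
  \<comment> \<open>Stated for every list \<open>ls\<close> of members, because \<open>ks\<close> is
    fixed by the outer induction.\<close>
  have comm: "prod_list (map f ls) * g k \<sim> g k * prod_list (map f ls)" if "set ls \<subseteq> set (k # ks)" for ls
    using that
  proof (induction ls)
    case (Cons l ls)
    have "f l * (prod_list (map f ls) * g k) \<sim> f l * (g k * prod_list (map f ls))"
      using Cons.IH Cons.prems by (intro scong_mult[OF scong_refl]) auto
    also have "f l * (g k * prod_list (map f ls)) = (f l * g k) * prod_list (map f ls)"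
      by (simp add: mult.assoc)
    also have "\<dots> \<sim> (g k * f l) * prod_list (map f ls)"
      using Cons.prems \<open>\<And>k' l. k' \<in> set (k # ks) \<Longrightarrow> l \<in> set (k # ks) \<Longrightarrow> f k' * g l \<sim> g l * f k'\<close>
      by (intro scong_mult[OF _ scong_refl]) auto
    finally show ?case by (simp add: mult.assoc)
  qed simp
  have "f k * prod_list (map f ks) * (g k * prod_list (map g ks)) =
      f k * (prod_list (map f ks) * g k) * prod_list (map g ks)"
    by (simp add: mult.assoc)
  also have "\<dots> \<sim> f k * (g k * prod_list (map f ks)) * prod_list (map g ks)"
    using comm[of ks] by (intro scong_mult[OF scong_mult[OF scong_refl] scong_refl]) auto
  also have "\<dots> = f k * g k * (prod_list (map f ks) * prod_list (map g ks))"
    by (simp add: mult.assoc)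
  also have "\<dots> \<sim> f k * g k * prod_list (map (\<lambda>k. f k * g k) ks)"
    using Cons by (intro scong_mult[OF scong_refl]) auto
  finally show ?case by simp
qed simp

end

section \<open>Quantum binomials and the quantum Serre expression\<close>

definition qbinom :: "'a::field \<Rightarrow> nat \<Rightarrow> nat \<Rightarrow> 'a" where
  "qbinom v n k = (if k \<le> n then qfact v n / (qfact v k * qfact v (n - k)) else 0)"

definition not_root_of_unity :: "'a::field \<Rightarrow> bool" where
  "not_root_of_unity v \<longleftrightarrow> v \<noteq> 0 \<and> (\<forall>z::int. z \<noteq> 0 \<longrightarrow> v powi z \<noteq> 1)"

lemma qfact_Suc: "qfact v (Suc k) = qfact v k * qint v (Suc k)"
  by (simp add: qfact_def)

context
  fixes v :: "'a::field"
  assumes v_not_root: "not_root_of_unity v"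
begin

lemma v0: "v \<noteq> 0"
  using v_not_root by (simp add: not_root_of_unity_def)

lemma qint_nonzero: "k > 0 \<Longrightarrow> qint v k \<noteq> 0"
proof -
  have *: "v powi z - v powi (- z) \<noteq> 0" if "z \<noteq> 0" for z
  proof
    assume "v powi z - v powi (- z) = 0"
    then have "v powi z * v powi z = 1" using v0 by (simp add: power_int_minus field_simps)
    then have "v powi (z + z) = 1" using v0 by (subst power_int_add) auto
    then show False using v_not_root that by (simp add: not_root_of_unity_def)
  qed
  show "k > 0 \<Longrightarrow> qint v k \<noteq> 0"
    using *[of "int k"] *[of 1] by (simp add: qint_def)
qed

lemma qfact_nonzero: "qfact v k \<noteq> 0"
  using qint_nonzero by (auto simp: qfact_def)

text \<open>The mixed powers \<open>v^(k-l)\<close> of the two products cancel.\<close>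

lemma qint_add: "qint v (k + l) = v powi int k * qint v l + v powi (- int l) * qint v k"
proof -
  have "v powi int (k + l) = v powi int k * v powi int l"
    "v powi (- int (k + l)) = v powi (- int k) * v powi (- int l)"
    using power_int_add[of v "int k" "int l"] power_int_add[of v "- int k" "- int l"] v0 by auto
  then have "v powi int (k + l) - v powi (- int (k + l)) =
      v powi int k * (v powi int l - v powi (- int l)) + v powi (- int l) * (v powi int k - v powi (- int k))"
    by (simp only: right_diff_distrib mult.commute) simp
  then show ?thesis by (simp only: qint_def add_divide_distrib times_divide_eq_right)
qed

text \<open>Pascal rule for balanced Gaussian binomials. After cancelling factorials it is
  \<open>qint_add\<close> for the decomposition \<open>n + 1 = (k + 1) + (n - k)\<close>.\<close>

lemma qbinom_Suc_Suc:
  "qbinom v (Suc n) (Suc k) = v powi int (Suc k) * qbinom v n (Suc k) + v powi (int k - int n) * qbinom v n k"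
proof (cases "Suc k \<le> n")
  case True
  define l where "l = n - Suc k"
  have n: "n = Suc (k + l)" using True by (simp add: l_def)
  have e: "int k - int n = - int (Suc l)" by (simp add: n)
  have "qint v (Suc n) = v powi int (Suc k) * qint v (Suc l) + v powi (- int (Suc l)) * qint v (Suc k)"
    using qint_add[of "Suc k" "Suc l"] by (simp add: n)
  then show ?thesis
    using qfact_nonzero[of k] qfact_nonzero[of l] qint_nonzero[of "Suc k"] qint_nonzero[of "Suc l"]
    unfolding e qbinom_def
    by (simp add: n qfact_Suc field_simps del: of_nat_Suc)
next
  case False
  then show ?thesis using qfact_nonzero qint_nonzero[of "Suc n"]
    by (auto simp: qbinom_def not_less_eq_eq qfact_def)
qed

lemma qbinom_0 [simp]: "qbinom v n 0 = 1"
  using qfact_nonzero by (simp add: qbinom_def qfact_def)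

end

lemma qbinom_eq_0: "n < k \<Longrightarrow> qbinom v n k = 0"
  by (simp add: qbinom_def)

text \<open>For \<open>u = 1\<close>, \<open>v = q_i\<close> and \<open>N = 1 - a_ij\<close> this is
  the Serre expression in divided powers times \<open>qfact v N\<close>. The parameter
  \<open>u\<close> makes the recursion in \<open>N\<close> close up.\<close>

definition qserre_sum :: "'a::field \<Rightarrow> nat \<Rightarrow> 'a \<Rightarrow> ('g, 'a) ncpoly \<Rightarrow> ('g, 'a) ncpoly \<Rightarrow> ('g, 'a) ncpoly" where
  "qserre_sum v N u x y = (\<Sum>k\<le>N. Const ((- u) ^ k * qbinom v N k) * (x ^ k * y * x ^ (N - k)))"


text \<open>Left and right multiplication by \<open>x\<close> commute, so the sum is a polynomial in
  these two operators applied to \<open>y\<close>. The Pascal rule splits off one linear factor, a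
  \<open>q\<close>-commutator with \<open>x\<close>; iterating this turns the Serre expression into
  an iterated \<open>q\<close>-commutator.\<close>

lemma qserre_sum_Suc:
  assumes "not_root_of_unity v"
  shows "qserre_sum v (Suc N) u x y =
    qserre_sum v N (u * v) x (y * x - Const (u * v powi (- int N)) * (x * y))"
proof -
  let ?X = "\<lambda>k. x ^ Suc k * y * x ^ (N - k)"
  let ?b = "qbinom v N"
  note qb0 = qbinom_0[OF assms]
  have coeff: "(- u) ^ Suc k * qbinom v (Suc N) (Suc k) =
      (- (u * v)) ^ Suc k * ?b (Suc k) - (- (u * v)) ^ k * ?b k * (u * v powi (- int N))" for k
  proof -
    have "(- (u * v)) ^ k * (?b k * (u * v powi (- int N))) = - ((- u) ^ Suc k * (v powi (int k - int N) * ?b k))"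
      using power_int_add[of v "int k" "- int N"] v0[OF assms] by (simp add: power_mult_distrib minus_mult_left del: mult_minus_left)
    moreover have "(- (u * v)) ^ Suc k = (- u) ^ Suc k * v powi int (Suc k)"
      by (simp only: power_mult_distrib minus_mult_left power_int_of_nat)
    moreover have "qbinom v (Suc N) (Suc k) =
        v powi int (Suc k) * ?b (Suc k) + v powi (int k - int N) * ?b k"
      by (rule qbinom_Suc_Suc[OF assms])
    ultimately show ?thesis
      by (simp only: distrib_left mult.assoc diff_minus_eq_add)
  qed
  \<comment> \<open>The added term \<open>k = Suc N\<close> is zero. Separating the term
    \<open>k = 0\<close> then leaves exactly the products \<open>?X\<close>.\<close>
  have "(\<Sum>k\<le>N. Const ((- (u * v)) ^ k * ?b k) * (x ^ k * y * x ^ (Suc N - k))) =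
      (\<Sum>k\<le>Suc N. Const ((- (u * v)) ^ k * ?b k) * (x ^ k * y * x ^ (Suc N - k)))"
    by (simp add: qbinom_eq_0)
  also have "\<dots> = y * x ^ Suc N + (\<Sum>k\<le>N. Const ((- (u * v)) ^ Suc k * ?b (Suc k)) * ?X k)"
    by (subst sum.atMost_Suc_shift) (simp add: qb0)
  finally have shift: "(\<Sum>k\<le>N. Const ((- (u * v)) ^ k * ?b k) * (x ^ k * y * x ^ (Suc N - k))) =
      y * x ^ Suc N + (\<Sum>k\<le>N. Const ((- (u * v)) ^ Suc k * ?b (Suc k)) * ?X k)" .
  have "qserre_sum v (Suc N) u x y =
      y * x ^ Suc N + (\<Sum>k\<le>N. Const ((- u) ^ Suc k * qbinom v (Suc N) (Suc k)) * ?X k)"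
    unfolding qserre_sum_def by (subst sum.atMost_Suc_shift) (simp add: qbinom_0[OF assms])
  also have "\<dots> = (\<Sum>k\<le>N. Const ((- (u * v)) ^ k * ?b k) * (x ^ k * y * x ^ (Suc N - k))) -
      (\<Sum>k\<le>N. Const ((- (u * v)) ^ k * ?b k * (u * v powi (- int N))) * ?X k)"
    unfolding shift coeff Const_diff left_diff_distrib sum_subtractf by simp
  also have "\<dots> = qserre_sum v N (u * v) x (y * x - Const (u * v powi (- int N)) * (x * y))"
    unfolding qserre_sum_def sum_subtractf[symmetric]
  proof (rule sum.cong[OF refl])
    fix k assume "k \<in> {..N}"
    then have "Suc N - k = Suc (N - k)" by auto
    then have 1: "x ^ k * y * x ^ (Suc N - k) = x ^ k * (y * x) * x ^ (N - k)"
      by (simp add: mult.assoc)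
    have 2: "?X k = x ^ k * (x * y) * x ^ (N - k)"
      by (simp only: power_Suc2 mult.assoc)
    show "Const ((- (u * v)) ^ k * ?b k) * (x ^ k * y * x ^ (Suc N - k)) -
        Const ((- (u * v)) ^ k * ?b k * (u * v powi (- int N))) * ?X k =
        Const ((- (u * v)) ^ k * ?b k) * (x ^ k * (y * x - Const (u * v powi (- int N)) * (x * y)) * x ^ (N - k))"
      unfolding 1 2 Const_mult[of _ "u * v powi _"]
      by (simp only: right_diff_distrib left_diff_distrib mult.assoc Const_left_commute[of "x ^ k"])
  qed
  finally show ?thesis .
qed

lemma qserre_sum_Const_mult: "qserre_sum v N u x (Const c * y) = Const c * qserre_sum v N u x y"
  unfolding qserre_sum_def sum_distrib_left
  by (intro sum.cong refl)
    (simp only: mult.assoc Const_left_commute[of "x ^ _"] Const_left_commute[of "Const ((- u) ^ _ * _)"])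

section \<open>Vanishing of the Serre expression on sums of two \<open>q\<close>-commuting
  elements\<close>

context ncpoly_congruence
begin

lemma congr_qserre_sum: "y \<approx> y' \<Longrightarrow> qserre_sum v N u x y \<approx> qserre_sum v N u x y'"
  unfolding qserre_sum_def by (intro congr_sum congr_lmult congr_rmult)

text \<open>The iterated \<open>q\<close>-commutators of \<open>y\<close> with \<open>s + t\<close> stay monomials \<open>y t\<^sup>r\<close>: each factor kills the
  contribution of \<open>s\<close>, and the last one kills that of \<open>t\<close> as well.\<close>

lemma qserre_sum_congr_0_aux:
  assumes v: "not_root_of_unity v"
    and s: "qcomm (v powi int (r + j)) s y"
    and t: "qcomm (v powi (- int (r + j))) t y"
    and ts: "qcomm (v ^ 2) t s"
  shows "qserre_sum v (Suc j) (v ^ r) (s + t) (y * t ^ r) \<approx> 0"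
  using s t
proof (induction j arbitrary: r)
  have step: "qserre_sum v (Suc j) (v ^ r) (s + t) (y * t ^ r) \<approx>
      Const (1 - v powi (- 2 * int j)) * qserre_sum v j (v ^ Suc r) (s + t) (y * t ^ Suc r)"
    if s: "qcomm (v powi int (r + j)) s y" and t: "qcomm (v powi (- int (r + j))) t y" for r j
  proof -
    define M where "M = y * t ^ r"
    \<comment> \<open>The coefficient split off by \<open>qserre_sum_Suc\<close>. It is inverse to
      the factor with which \<open>s\<close> passes \<open>M\<close>, so the \<open>s\<close> part
      of the \<open>q\<close>-commutator cancels; the \<open>t\<close> part survives with
      coefficient \<open>1 - v powi (- 2 * int j)\<close>, which is zero for
      \<open>j = 0\<close>.\<close>
    define w where "w = v ^ r * v powi (- int j)"
    have w: "w = v powi (int r - int j)"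
      using power_int_add[of v "int r" "- int j"] v0[OF v] by (simp add: w_def)
    have sM: "qcomm (v powi (int j - int r)) s M"
    proof -
      have "qcomm (v powi int (r + j) * inverse (v ^ 2) ^ r) s M"
        unfolding M_def by (intro qcomm_mult_right s qcomm_power_right qcomm_sym ts)
      moreover have "inverse (v ^ 2) ^ r = v powi (- 2 * int r)"
      proof -
        have "v powi (- 2 * int r) = inverse (v powi int (2 * r))"
          by (simp only: power_int_minus[symmetric]) simp
        then show ?thesis by (simp only: power_int_of_nat power_mult power_inverse)
      qed
      ultimately show ?thesis
        using power_int_add[of v "int (r + j)" "- 2 * int r"] v0[OF v] by (simp add: algebra_simps)
    qed
    have tM: "qcomm (v powi (- int (r + j))) t M"
      using qcomm_mult_right[OF t qcomm_power_right[OF qcomm_refl]] by (simp add: M_def)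
    have "Const w * (s * M) \<approx> Const w * (Const (v powi (int j - int r)) * (M * s))"
      by (intro congr_lmult qcommD sM)
    also have "\<dots> = M * s"
      using power_int_add[of v "int r - int j" "int j - int r"] v0[OF v] by (simp add: Const_mult_Const w)
    finally have 1: "Const w * (s * M) \<approx> M * s" .
    have "Const w * (t * M) \<approx> Const w * (Const (v powi (- int (r + j))) * (M * t))"
      by (intro congr_lmult qcommD tM)
    also have "\<dots> = Const (v powi (- 2 * int j)) * (M * t)"
      using power_int_add[of v "int r - int j" "- int (r + j)"] v0[OF v] by (simp add: Const_mult_Const w)
    finally have 2: "Const w * (t * M) \<approx> Const (v powi (- 2 * int j)) * (M * t)" .
    have "M * (s + t) - Const w * ((s + t) * M) =
        (M * s + M * t) - (Const w * (s * M) + Const w * (t * M))"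
      by (simp add: algebra_simps)
    also have "\<dots> \<approx> (M * s + M * t) - (M * s + Const (v powi (- 2 * int j)) * (M * t))"
      by (intro congr_diff congr_add congr_refl 1 2)
    also have "\<dots> = Const (1 - v powi (- 2 * int j)) * (M * t)"
      by (simp add: Const_diff algebra_simps)
    also have "M * t = y * t ^ Suc r"
      by (simp add: M_def mult.assoc power_commutes)
    finally have "M * (s + t) - Const w * ((s + t) * M) \<approx> Const (1 - v powi (- 2 * int j)) * (y * t ^ Suc r)" .
    from congr_qserre_sum[OF this, of v j "v ^ Suc r" "s + t"] show ?thesis
      unfolding qserre_sum_Suc[OF v] qserre_sum_Const_mult M_def w_def
      by (simp add: mult.commute)
  qed
  {
    case (0 r)
    then show ?case using step[of r 0] by simp
  next
    case (Suc j r)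
    \<comment> \<open>The sum \<open>r + j\<close> does not change along the recursion, so the
      hypotheses on \<open>s\<close> and \<open>t\<close> carry over.\<close>
    have "qserre_sum v (Suc j) (v ^ Suc r) (s + t) (y * t ^ Suc r) \<approx> 0"
      using Suc.prems by (intro Suc.IH) simp_all
    from congr_trans[OF step[OF Suc.prems] congr_lmult[OF this]] show ?case
      by simp
  }
qed

lemma qserre_sum_congr_0:
  assumes v: "not_root_of_unity v"
    and s: "qcomm (v powi int j) s y"
    and t: "qcomm (v powi (- int j)) t y"
    and ts: "qcomm (v ^ 2) t s"
  shows "qserre_sum v (Suc j) 1 (s + t) y \<approx> 0"
  using qserre_sum_congr_0_aux[of v 0 j s y t] assms by simp

end

section \<open>The Feigin homomorphism\<close>

context
  fixes G :: "'g set" and R :: "('g, 'a::field) ncpoly set"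
  assumes R_carrier: "R \<subseteq> carrier (free_alg G)"
begin

lemma ideal_Idl: "ideal (Idl\<^bsub>free_alg G\<^esub> R) (free_alg G)"
  using R_carrier by (intro ring.genideal_ideal ring_free_alg)

lemma ring_presented_alg: "ring (presented_alg G R)"
  unfolding presented_alg_def by (rule ideal.quotient_is_ring[OF ideal_Idl])

lemma pclass_ring_hom: "pclass G R \<in> ring_hom (free_alg G) (presented_alg G R)"
  using ideal.rcos_ring_hom[OF ideal_Idl] by (simp add: pclass_def[abs_def] presented_alg_def)

lemma pclass_in: "f \<in> carrier (free_alg G) \<Longrightarrow> pclass G R f \<in> carrier (presented_alg G R)"
  using pclass_ring_hom by (rule ring_hom_closed)

lemma pclass_mult: "f \<in> carrier (free_alg G) \<Longrightarrow> g \<in> carrier (free_alg G) \<Longrightarrow>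
    pclass G R (f * g) = pclass G R f \<otimes>\<^bsub>presented_alg G R\<^esub> pclass G R g"
  using ring_hom_mult[OF pclass_ring_hom] by simp

lemma pclass_add: "f \<in> carrier (free_alg G) \<Longrightarrow> g \<in> carrier (free_alg G) \<Longrightarrow>
    pclass G R (f + g) = pclass G R f \<oplus>\<^bsub>presented_alg G R\<^esub> pclass G R g"
  using ring_hom_add[OF pclass_ring_hom] by simp

lemma pclass_one: "pclass G R 1 = \<one>\<^bsub>presented_alg G R\<^esub>"
  using ring_hom_one[OF pclass_ring_hom] by simp

lemma pclass_zero: "pclass G R 0 = \<zero>\<^bsub>presented_alg G R\<^esub>"
  using ring_hom_zero[OF pclass_ring_hom ring_free_alg ring_presented_alg] by simp

lemma pclass_power: "f \<in> carrier (free_alg G) \<Longrightarrow>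
    pclass G R (f ^ n) = pclass G R f [^]\<^bsub>presented_alg G R\<^esub> n"
  by (induction n) (simp_all add: pclass_one pclass_mult free_alg_power power_Suc2 del: power_Suc)

lemma pclass_finsum: "finite S \<Longrightarrow> (\<And>i. i \<in> S \<Longrightarrow> f i \<in> carrier (free_alg G)) \<Longrightarrow>
    (\<Oplus>\<^bsub>presented_alg G R\<^esub>i\<in>S. pclass G R (f i)) = pclass G R (\<Sum>i\<in>S. f i)"
proof (induction S rule: finite_induct)
  case empty
  interpret ring "presented_alg G R" by (rule ring_presented_alg)
  show ?case by (simp add: pclass_zero)
next
  case (insert x S)
  interpret ring "presented_alg G R" by (rule ring_presented_alg)
  have "(\<Oplus>\<^bsub>presented_alg G R\<^esub>i\<in>insert x S. pclass G R (f i)) =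
      pclass G R (f x) \<oplus>\<^bsub>presented_alg G R\<^esub> (\<Oplus>\<^bsub>presented_alg G R\<^esub>i\<in>S. pclass G R (f i))"
    using insert by (intro finsum_insert) (auto intro: pclass_in)
  then show ?case using insert by (simp add: pclass_add free_alg_sum)
qed

lemma pclass_oprod:
  assumes "\<And>k. k \<in> {1..m} \<Longrightarrow> f k \<in> carrier (free_alg G)"
  shows "oprod (presented_alg G R) (\<lambda>k. pclass G R (f k)) m = pclass G R (prod_list (map f [1..<Suc m]))"
proof -
  have "foldr (\<lambda>k x. pclass G R (f k) \<otimes>\<^bsub>presented_alg G R\<^esub> x) ks \<one>\<^bsub>presented_alg G R\<^esub> =
      pclass G R (prod_list (map f ks))" if "set ks \<subseteq> {1..m}" for ks
    using that
  proof (induction ks)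
    case (Cons k ks)
    then have "prod_list (map f ks) \<in> carrier (free_alg G)" "f k \<in> carrier (free_alg G)"
      using assms by (auto intro!: free_alg_prod_list simp: subset_iff)
    then show ?case using Cons by (simp add: pclass_mult)
  qed (simp add: pclass_one)
  from this[of "[1..<Suc m]"] show ?thesis
    by (simp add: oprod_def atLeastLessThanSuc_atLeastAtMost del: upt_Suc)
qed

lemma carrier_presented_alg: "carrier (presented_alg G R) = pclass G R ` carrier (free_alg G)"
  by (auto simp: presented_alg_def FactRing_def A_RCOSETS_def' pclass_def)

lemma pclass_eqI:
  assumes "f \<in> carrier (free_alg G)" "g \<in> carrier (free_alg G)" "f - g \<in> tideal R"
  shows "pclass G R f = pclass G R g"
proof -
  interpret ideal "Idl\<^bsub>free_alg G\<^esub> R" "free_alg G" by (rule ideal_Idl)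
  have "f - g \<in> Idl\<^bsub>free_alg G\<^esub> R"
    using assms R_carrier by (intro tideal_in_Idl free_alg_diff)
  then show ?thesis
    using quotient_eq_iff_same_a_r_cos[OF ideal_Idl assms(1,2)] assms
    by (simp add: pclass_def a_minus_free_alg)
qed

lemma pclass_eqD:
  assumes "f \<in> carrier (free_alg G)" "g \<in> carrier (free_alg G)" "pclass G R f = pclass G R g"
  shows "f - g \<in> Idl\<^bsub>free_alg G\<^esub> R"
proof -
  interpret ideal "Idl\<^bsub>free_alg G\<^esub> R" "free_alg G" by (rule ideal_Idl)
  show ?thesis
    using quotient_eq_iff_same_a_r_cos[OF ideal_Idl assms(1,2)] assms
    by (simp add: pclass_def a_minus_free_alg)
qed

end

section \<open>The parameter \<open>q\<close> is not a root of unity\<close>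

lemma qhalf_nonzero [simp]: "qhalf \<noteq> 0"
  by (simp add: qhalf_def)

lemma qhalf_power: "qhalf ^ n = to_fract (monom 1 n)"
proof (induction n)
  case (Suc n)
  have "[:0, 1:] * monom 1 n = (monom 1 (Suc n) :: 'a poly)"
    by (simp add: monom_Suc)
  then show ?case using Suc by (simp add: qhalf_def flip: to_fract_mult)
qed (simp add: monom_0 one_pCons flip: to_fract_1)

text \<open>A positive power of the indeterminate is a monomial of positive degree and so differs
  from 1; negative powers are inverses of these.\<close>

lemma not_root_of_unity_qhalf: "not_root_of_unity qhalf"
proof -
  have "qhalf ^ n \<noteq> (1 :: 'a qfield)" if "n > 0" for n
  proof
    assume "qhalf ^ n = (1 :: 'a qfield)"
    then have "monom 1 n = (1 :: 'a poly)"
      unfolding qhalf_power by (metis to_fract_1 to_fract_eq_iff)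
    then have "degree (monom (1::'a) n) = 0" by simp
    then show False using that by (simp add: degree_monom_eq)
  qed
  then have "qhalf powi z \<noteq> (1 :: 'a qfield)" if "z \<noteq> 0" for z
    using that by (cases "z \<ge> 0") (auto simp: power_int_def power_inverse inverse_eq_1_iff)
  then show ?thesis by (simp add: not_root_of_unity_def)
qed

lemma not_root_of_unity_power: "not_root_of_unity v \<Longrightarrow> n > 0 \<Longrightarrow> not_root_of_unity (v ^ n)"
  by (simp add: not_root_of_unity_def power_int_power)

lemma not_root_of_unity_qpar: "not_root_of_unity qpar"
  unfolding qpar_def by (intro not_root_of_unity_power not_root_of_unity_qhalf) simp

lemma qpar_nonzero [simp]: "qpar \<noteq> 0"
  by (simp add: qpar_def)

section \<open>The quantum torus of a word and the Serre relations in it\<close>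

text \<open>\<open>R\<close> is a parameter in order that the congruence notation of the parent
  locale refers to the torus relations.\<close>

locale feigin = ncpoly_congruence R for R :: "(tgen, 'k::field_char_0 qfield) ncpoly set" +
  fixes I :: "'i set" and A :: "'i \<Rightarrow> 'i \<Rightarrow> int" and d :: "'i \<Rightarrow> nat" and ws :: "'i list"
  assumes R: "R = torus_rels A d ws"
    and cartan: "symmetrizable_cartan I A d"
    and ws: "set ws \<subseteq> I"
begin

abbreviation "m \<equiv> length ws"
abbreviation "c \<equiv> csym A d"
abbreviation "t k \<equiv> Var (T k) :: (tgen, 'k qfield) ncpoly"
abbreviation "t' k \<equiv> Var (Tinv k) :: (tgen, 'k qfield) ncpoly"
abbreviation "TA \<equiv> free_alg (torus_gens m) :: (tgen, 'k qfield) ncpoly ring"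

lemma letter_in: "k \<in> {1..m} \<Longrightarrow> letter ws k \<in> I"
  using ws by (auto simp: letter_def subset_iff)

lemma c_sym: "i \<in> I \<Longrightarrow> j \<in> I \<Longrightarrow> c i j = c j i"
  using cartan by (auto simp: symmetrizable_cartan_def csym_def)

lemma R_carrier: "R \<subseteq> carrier TA"
  unfolding R torus_rels_def
  by (auto intro!: free_alg_intros simp: torus_gens_def)

lemma t_in: "k \<in> {1..m} \<Longrightarrow> t k \<in> carrier TA"
  and t'_in: "k \<in> {1..m} \<Longrightarrow> t' k \<in> carrier TA"
  by (auto intro!: free_alg_Var simp: torus_gens_def)

lemma t_t': "k \<in> {1..m} \<Longrightarrow> t k * t' k \<approx> 1"
  and t'_t: "k \<in> {1..m} \<Longrightarrow> t' k * t k \<approx> 1"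
  unfolding congr_def by (intro tideal_base; auto simp: R torus_rels_def)+

lemma t_qcomm:
  assumes "1 \<le> k" "k < l" "l \<le> m"
  shows "qcomm (qpar powi c (letter ws k) (letter ws l)) (t l) (t k)"
proof -
  have "t l * t k - Const (qpar powi c (letter ws k) (letter ws l)) * t k * t l \<in> R"
    using assms by (auto simp: R torus_rels_def)
  then show ?thesis by (simp add: qcomm_def congr_def tideal_base mult.assoc)
qed

lemma tclass_eq: "f \<in> carrier TA \<Longrightarrow> g \<in> carrier TA \<Longrightarrow> f \<approx> g \<Longrightarrow> tclass A d ws f = tclass A d ws g"
  unfolding tclass_def R[symmetric] by (rule pclass_eqI[OF R_carrier]) (auto simp: congr_def)

text \<open>The prescribed image of \<open>x_j\<close>, as a representative in the free
  algebra.\<close>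

definition sigma :: "'i \<Rightarrow> (tgen, 'k qfield) ncpoly" where
  "sigma j = (\<Sum>k\<in>{k \<in> {1..m}. letter ws k = j}. t k)"

lemma sigma_in: "sigma j \<in> carrier TA"
  unfolding sigma_def by (auto intro!: free_alg_sum t_in)

lemma subst_sigma_in: "subst sigma f \<in> carrier TA"
  by (rule subst_in_free_alg[OF sigma_in])

lemma serre_in: "i \<in> I \<Longrightarrow> j \<in> I \<Longrightarrow> serre A d i j \<in> carrier (free_alg I)"
  unfolding serre_def divpow_def Let_def by (intro free_alg_intros) auto

lemma serre_rels_carrier: "serre_rels I A d \<subseteq> carrier (free_alg I)"
  by (auto simp: serre_rels_def intro: serre_in)

lemma not_root_of_unity_qi: "i \<in> I \<Longrightarrow> not_root_of_unity (qpar ^ d i :: 'k qfield)"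
  using cartan by (intro not_root_of_unity_power not_root_of_unity_qpar) (auto simp: symmetrizable_cartan_def)

lemma subst_serre:
  assumes "i \<in> I" "N = nat (1 - A i j)"
  shows "subst sigma (serre A d i j) =
    Const (inverse (qfact (qpar ^ d i) N)) * qserre_sum (qpar ^ d i) N 1 (sigma i) (sigma j)"
proof -
  let ?v = "qpar ^ d i :: 'k qfield"
  have "subst sigma (serre A d i j) = (\<Sum>k=0..N. (- 1) ^ k * (Const (inverse (qfact ?v k)) * sigma i ^ k) *
      sigma j * (Const (inverse (qfact ?v (N - k))) * sigma i ^ (N - k)))"
    by (simp add: serre_def divpow_def Let_def assms(2))
  also have "\<dots> = (\<Sum>k\<le>N. Const (inverse (qfact ?v N)) *
      (Const ((- 1) ^ k * qbinom ?v N k) * (sigma i ^ k * sigma j * sigma i ^ (N - k))))"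
    unfolding atLeast0AtMost
  proof (intro sum.cong refl)
    fix k assume "k \<in> {..N}"
    then have k: "inverse (qfact ?v N) * ((- 1) ^ k * qbinom ?v N k) =
        (- 1) ^ k * inverse (qfact ?v k) * inverse (qfact ?v (N - k))"
      using qfact_nonzero[OF not_root_of_unity_qi[OF assms(1)]] by (simp add: qbinom_def field_simps)
    have sgn: "(- 1) ^ k = Const ((- 1) ^ k :: 'k qfield)"
      by (induction k) (simp_all add: Const_uminus)
    show "(- 1) ^ k * (Const (inverse (qfact ?v k)) * sigma i ^ k) * sigma j *
        (Const (inverse (qfact ?v (N - k))) * sigma i ^ (N - k)) =
        Const (inverse (qfact ?v N)) * (Const ((- 1) ^ k * qbinom ?v N k) * (sigma i ^ k * sigma j * sigma i ^ (N - k)))"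
      unfolding Const_mult_Const k sgn
      by (simp only: Const_mult mult.assoc Const_left_commute[of "sigma i ^ _"] Const_left_commute[of "sigma j"])
  qed
  finally show ?thesis by (simp add: qserre_sum_def sum_distrib_left)
qed

text \<open>The Serre expression is linear in its second argument, so one \<open>t p\<close> with
  letter \<open>j\<close> is treated at a time. The summands of \<open>sigma i\<close> before and
  after position \<open>p\<close> pass \<open>t p\<close> with opposite exponents, and pass each
  other with factor \<open>q_i^2\<close>; this is the situation of
  \<open>qserre_sum_congr_0\<close>.\<close>

lemma subst_serre_congr_0:
  assumes "i \<in> I" "j \<in> I" "i \<noteq> j"
  shows "subst sigma (serre A d i j) \<approx> 0"
proof -
  let ?v = "qpar ^ d i :: 'k qfield"
  define a where "a = nat (- A i j)"
  have "A i j \<le> 0" using cartan assms by (auto simp: symmetrizable_cartan_def)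
  then have a: "int a = - A i j" "nat (1 - A i j) = Suc a"
    by (auto simp: a_def)
  have qpi: "qpar powi c i j = ?v powi (- int a)"
    by (simp add: csym_def power_int_power a)
  have qii: "qpar powi c i i = ?v ^ 2"
    using cartan assms(1) by (simp add: csym_def symmetrizable_cartan_def power_int_nonneg_exp mult.commute power_mult nat_mult_distrib)
  have v0: "?v \<noteq> 0" by simp
  have single: "qserre_sum ?v (Suc a) 1 (sigma i) (t p) \<approx> 0" if p: "p \<in> {1..m}" "letter ws p = j" for p
  proof -
    let ?S = "\<lambda>P. \<Sum>k\<in>{k \<in> {1..m}. letter ws k = i \<and> P k}. t k"
    have split: "{k \<in> {1..m}. letter ws k = i} =
        {k \<in> {1..m}. letter ws k = i \<and> k < p} \<union> {k \<in> {1..m}. letter ws k = i \<and> p < k}"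
      using p assms(3) by (auto simp: not_less le_less)
    have sigma_i: "sigma i = ?S (\<lambda>k. k < p) + ?S (\<lambda>k. p < k)"
      unfolding sigma_def by (subst split, rule sum.union_disjoint) auto
    have "qcomm (inverse (?v powi (- int a))) (?S (\<lambda>k. k < p)) (t p)"
    proof (rule qcomm_sum_left)
      fix k assume "k \<in> {k \<in> {1..m}. letter ws k = i \<and> k < p}"
      then show "qcomm (inverse (?v powi (- int a))) (t k) (t p)"
        using t_qcomm[of k p] p by (intro qcomm_sym) (simp add: qpi)
    qed simp
    then have s: "qcomm (?v powi int a) (?S (\<lambda>k. k < p)) (t p)"
      by (simp add: power_int_minus)
    have t: "qcomm (?v powi (- int a)) (?S (\<lambda>k. p < k)) (t p)"
    proof (rule qcomm_sum_left)
      fix k assume "k \<in> {k \<in> {1..m}. letter ws k = i \<and> p < k}"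
      then show "qcomm (?v powi (- int a)) (t k) (t p)"
        using t_qcomm[of p k] p by (simp add: qpi c_sym[OF assms(2,1)])
    qed simp
    have ts: "qcomm (?v ^ 2) (?S (\<lambda>k. p < k)) (?S (\<lambda>k. k < p))"
    proof (intro qcomm_sum_left qcomm_sum_right)
      fix k l assume "k \<in> {k \<in> {1..m}. letter ws k = i \<and> p < k}" "l \<in> {k \<in> {1..m}. letter ws k = i \<and> k < p}"
      then show "qcomm (?v ^ 2) (t k) (t l)"
        using t_qcomm[of l k] by (simp add: qii)
    qed simp_all
    show ?thesis unfolding sigma_i
      by (rule qserre_sum_congr_0[OF not_root_of_unity_qi[OF assms(1)] s t ts])
  qed
  have "qserre_sum ?v (Suc a) 1 (sigma i) (sigma j) =
      (\<Sum>p\<in>{k \<in> {1..m}. letter ws k = j}. qserre_sum ?v (Suc a) 1 (sigma i) (t p))"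
    unfolding sigma_def[of j] qserre_sum_def sum_distrib_left sum_distrib_right
    by (rule sum.swap)
  also have "\<dots> \<approx> (\<Sum>p\<in>{k \<in> {1..m}. letter ws k = j}. 0)"
    by (rule congr_sum) (use single in auto)
  finally have "Const (inverse (qfact ?v (Suc a))) * qserre_sum ?v (Suc a) 1 (sigma i) (sigma j) \<approx>
      Const (inverse (qfact ?v (Suc a))) * 0"
    by (intro congr_lmult) simp
  then show ?thesis using subst_serre[OF assms(1), of "Suc a" j] a by simp
qed

lemma tclass_ring_hom: "tclass A d ws \<in> ring_hom TA (torus A d ws)"
  using pclass_ring_hom[OF R_carrier] by (simp add: R tclass_def[abs_def] torus_def)

lemmas tclass_mult = pclass_mult[OF R_carrier, unfolded R, folded tclass_def torus_def]
  and tclass_add = pclass_add[OF R_carrier, unfolded R, folded tclass_def torus_def]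
  and tclass_one = pclass_one[OF R_carrier, unfolded R, folded tclass_def torus_def]
  and tclass_power = pclass_power[OF R_carrier, unfolded R, folded tclass_def torus_def]
  and tclass_finsum = pclass_finsum[OF R_carrier, unfolded R, folded tclass_def torus_def]
  and tclass_oprod = pclass_oprod[OF R_carrier, unfolded R, folded tclass_def torus_def]

section \<open>Existence and uniqueness of the Feigin homomorphism\<close>

abbreviation "U \<equiv> Uplus I A d :: ('i, 'k qfield) ncpoly set ring"
abbreviation "ucl f \<equiv> pclass I (serre_rels I A d) (f :: ('i, 'k qfield) ncpoly)"

lemma ucl_ring_hom: "ucl \<in> ring_hom (free_alg I) U"
  using pclass_ring_hom[OF serre_rels_carrier] by (simp add: Uplus_def)

lemma carrier_U: "carrier U = ucl ` carrier (free_alg I)"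
  unfolding Uplus_def by (rule carrier_presented_alg[OF serre_rels_carrier])

lemma sigma_in_finsum: "(\<Oplus>\<^bsub>torus A d ws\<^esub>k\<in>{k \<in> {1..m}. letter ws k = j}. tclass A d ws (t k)) = tclass A d ws (sigma j)"
  unfolding sigma_def by (intro tclass_finsum t_in) auto

text \<open>Well-definedness on the quotient: \<open>subst sigma\<close> sends the Serre relations
  into the ideal of torus relations.\<close>

lemma subst_sigma_congr:
  assumes "f \<in> carrier (free_alg I)" "g \<in> carrier (free_alg I)" "ucl f = ucl g"
  shows "subst sigma f \<approx> subst sigma g"
proof -
  have "subst sigma (f - g) \<in> tideal R"
  proof (rule subst_Idl_in_tideal[OF serre_rels_carrier])
    show "f - g \<in> Idl\<^bsub>free_alg I\<^esub> (serre_rels I A d)"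
      by (rule pclass_eqD[OF serre_rels_carrier assms])
    show "subst sigma r \<in> tideal R" if "r \<in> serre_rels I A d" for r
      using that subst_serre_congr_0 by (auto simp: serre_rels_def congr_def)
  qed
  then show ?thesis by (simp add: congr_def)
qed

definition Psi_pred :: "(('i, 'k qfield) ncpoly set \<Rightarrow> (tgen, 'k qfield) ncpoly set) \<Rightarrow> bool" where
  "Psi_pred h \<longleftrightarrow> h \<in> extensional (carrier U) \<and> h \<in> ring_hom U (torus A d ws) \<and>
     (\<forall>c. h (Uscalar I A d c) = tclass A d ws (Const c)) \<and>
     (\<forall>j\<in>I. h (Ux I A d j) = tclass A d ws (sigma j))"

text \<open>Scalars and generators determine a homomorphism on words, hence on finite linear
  combinations of words.\<close>

lemma Psi_pred_unique:
  assumes "Psi_pred h" "f \<in> carrier (free_alg I)"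
  shows "h (ucl f) = tclass A d ws (subst sigma f)"
proof -
  let ?h = "\<lambda>f. h (ucl f)" and ?g = "\<lambda>f. tclass A d ws (subst sigma f)"
  have h: "h \<in> ring_hom U (torus A d ws)" using assms by (simp add: Psi_pred_def)
  have hm: "?h \<in> ring_hom (free_alg I) (torus A d ws)"
    using ring_hom_trans[OF ucl_ring_hom h] by (simp add: comp_def)
  have mult: "?h (f * g) = ?h f \<otimes>\<^bsub>torus A d ws\<^esub> ?h g"
    if "f \<in> carrier (free_alg I)" "g \<in> carrier (free_alg I)" for f g
    using ring_hom_mult[OF hm that] by simp
  have add: "?h (f + g) = ?h f \<oplus>\<^bsub>torus A d ws\<^esub> ?h g"
    if "f \<in> carrier (free_alg I)" "g \<in> carrier (free_alg I)" for f g
    using ring_hom_add[OF hm that] by simp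
  have const: "?h (Const c) = ?g (Const c)" for c
    using assms by (simp add: Psi_pred_def Uscalar_def)
  have word: "?h (prod_list (map Var ls)) = ?g (prod_list (map Var ls))" if "set ls \<subseteq> I" for ls
    using that
  proof (induction ls)
    case Nil
    show ?case using const[of 1] by simp
  next
    case (Cons l ls)
    then have in_carrier: "prod_list (map Var ls) \<in> (carrier (free_alg I) :: ('i, 'k qfield) ncpoly set)"
      by (auto intro!: free_alg_intros)
    have "?h (Var l) = tclass A d ws (sigma l)"
      using assms Cons.prems by (simp add: Psi_pred_def Ux_def)
    then show ?case
      using Cons in_carrier by (simp add: mult free_alg_Var tclass_mult sigma_in subst_sigma_in)
  qed
  have sum: "?h (\<Sum>w\<in>W. Const (b w) * prod_list (map Var (letters w))) =
      ?g (\<Sum>w\<in>W. Const (b w) * prod_list (map Var (letters w)))"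
    if "finite W" "\<And>w. w \<in> W \<Longrightarrow> set (letters w) \<subseteq> I" for W b
    using that
  proof (induction W rule: finite_induct)
    case empty
    show ?case using const[of 0] by simp
  next
    case (insert w W)
    let ?f = "\<lambda>w. Const (b w) * prod_list (map Var (letters w))"
    have p: "prod_list (map Var (letters w)) \<in> (carrier (free_alg I) :: ('i, 'k qfield) ncpoly set)"
      using insert.prems[of w] by (auto intro!: free_alg_intros)
    have in_carrier: "?f v \<in> carrier (free_alg I)" if "v \<in> insert w W" for v
      using insert.prems[of v] that by (auto intro!: free_alg_intros)
    then have "(\<Sum>w\<in>W. ?f w) \<in> carrier (free_alg I)" by (auto intro!: free_alg_sum)
    then have "?h (\<Sum>w\<in>insert w W. ?f w) = ?h (?f w) \<oplus>\<^bsub>torus A d ws\<^esub> ?h (\<Sum>w\<in>W. ?f w)"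
      using insert.hyps in_carrier by (simp add: add)
    also have "?h (?f w) = ?g (?f w)"
      using insert.prems[of w]
      by (simp add: mult p free_alg_Const const word tclass_mult subst_sigma_in)
    also have "?h (\<Sum>w\<in>W. ?f w) = ?g (\<Sum>w\<in>W. ?f w)"
      using insert by simp
    finally show ?case
      using insert.hyps by (simp add: tclass_add subst_sigma_in free_alg_sum free_alg_mult del: subst_mult subst_sum)
  qed
  show ?thesis
    using sum[of "Poly_Mapping.keys f" "Poly_Mapping.lookup f"] assms(2) subst_id[of f]
    by (simp add: carrier_free_alg subst_def[of Var] del: subst_sum subst_mult)
qed

lemma Psi_pred_exists: "\<exists>h. Psi_pred h"
proof -
  \<comment> \<open>The value is read off an arbitrary representative, and
    \<open>subst_sigma_congr\<close> makes it independent of the choice. The restriction provides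
    extensionality.\<close>
  define h where "h = restrict (\<lambda>X. tclass A d ws (subst sigma (SOME f. f \<in> carrier (free_alg I) \<and> X = ucl f))) (carrier U)"
  have h: "h (ucl f) = tclass A d ws (subst sigma f)" if f: "f \<in> carrier (free_alg I)" for f
  proof -
    define g where "g = (SOME g. g \<in> carrier (free_alg I) \<and> ucl f = ucl g)"
    have "g \<in> carrier (free_alg I) \<and> ucl f = ucl g"
      unfolding g_def by (rule someI[of _ f]) (use f in simp)
    then have "tclass A d ws (subst sigma g) = tclass A d ws (subst sigma f)"
      using f by (intro tclass_eq subst_sigma_in subst_sigma_congr) auto
    then show ?thesis using f by (simp add: h_def carrier_U g_def)
  qed
  have hom: "h \<in> ring_hom U (torus A d ws)"
  proof (rule ring_hom_memI)
    fix X assume "X \<in> carrier U"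
    then show "h X \<in> carrier (torus A d ws)"
      using h ring_hom_closed[OF tclass_ring_hom subst_sigma_in] by (auto simp: carrier_U)
  next
    fix X Y assume "X \<in> carrier U" "Y \<in> carrier U"
    then obtain f g where fg: "f \<in> carrier (free_alg I)" "X = ucl f" "g \<in> carrier (free_alg I)" "Y = ucl g"
      by (auto simp: carrier_U)
    have "X \<otimes>\<^bsub>U\<^esub> Y = ucl (f * g)" "X \<oplus>\<^bsub>U\<^esub> Y = ucl (f + g)"
      using fg ring_hom_mult[OF ucl_ring_hom, of f g] ring_hom_add[OF ucl_ring_hom, of f g] by simp_all
    then show "h (X \<otimes>\<^bsub>U\<^esub> Y) = h X \<otimes>\<^bsub>torus A d ws\<^esub> h Y" "h (X \<oplus>\<^bsub>U\<^esub> Y) = h X \<oplus>\<^bsub>torus A d ws\<^esub> h Y"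
      using fg by (simp_all add: h free_alg_mult free_alg_add tclass_mult tclass_add subst_sigma_in)
  next
    have "\<one>\<^bsub>U\<^esub> = ucl 1" using ring_hom_one[OF ucl_ring_hom] by simp
    then show "h \<one>\<^bsub>U\<^esub> = \<one>\<^bsub>torus A d ws\<^esub>" by (simp add: h free_alg_one tclass_one)
  qed
  have "Psi_pred h"
    unfolding Psi_pred_def using hom
    by (auto simp: Uscalar_def Ux_def h free_alg_Const free_alg_Var) (simp add: h_def)
  then show ?thesis by blast
qed

text \<open>Resolves the definite description; from here on \<open>Psi\<close> is evaluated only
  through this formula.\<close>

lemma Psi_ucl:
  assumes "f \<in> carrier (free_alg I)"
  shows "Psi I A d ws (ucl f) = tclass A d ws (subst sigma f)"
proof -
  obtain h where h: "Psi_pred h" using Psi_pred_exists by blast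
  have "Psi I A d ws = (THE h. Psi_pred h)"
    unfolding Psi_def Psi_pred_def sigma_in_finsum ..
  also have "\<dots> = h"
  proof (rule the_equality[where P = Psi_pred, OF h])
    fix h' assume h': "Psi_pred h'"
    show "h' = h"
    proof (rule extensionalityI)
      show "h' \<in> extensional (carrier U)" "h \<in> extensional (carrier U)"
        using h h' by (auto simp: Psi_pred_def)
    qed (auto simp: carrier_U Psi_pred_unique[OF h] Psi_pred_unique[OF h'])
  qed
  finally show ?thesis using Psi_pred_unique[OF h assms] by simp
qed

end

section \<open>Monomials in the image\<close>

lemma prod_list_indicator:
  "distinct ks \<Longrightarrow> k \<in> set ks \<Longrightarrow> prod_list (map (\<lambda>j. if j = k then x else (1::'a::monoid_mult)) ks) = x"
proof (induction ks)
  case (Cons l ks)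
  have "prod_list (map (\<lambda>j. if j = k then x else 1) ks) = 1" if "k \<notin> set ks"
    using that by (induction ks) auto
  then show ?case using Cons by auto
qed simp

lemma powi_inj:
  assumes "not_root_of_unity v" "v powi x = v powi y"
  shows "x = y"
proof -
  have "v powi (x - y) = 1"
    using assms power_int_diff[of v x y] by (simp add: not_root_of_unity_def)
  then have "x - y = 0" using assms unfolding not_root_of_unity_def by blast
  then show ?thesis by simp
qed

lemma prod_list_powi:
  assumes "(v :: 'a::field) \<noteq> 0" "distinct ks"
  shows "prod_list (map (\<lambda>k. v powi e k) ks) = v powi (\<Sum>k\<in>set ks. e k)"
  using assms(2) by (induction ks) (auto simp: power_int_add assms(1))

context feigin
begin

section \<open>Ordered monomials in the quantum torus\<close>

definition pw :: "nat \<Rightarrow> int \<Rightarrow> (tgen, 'k qfield) ncpoly" where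
  "pw k x = (if x \<ge> 0 then t k ^ nat x else t' k ^ nat (- x))"

text \<open>The power of \<open>qhalf\<close> that normalises \<open>tmon\<close> is left out, as
  monomials matter only up to scalars.\<close>

definition tmonomial :: "(nat \<Rightarrow> int) \<Rightarrow> (tgen, 'k qfield) ncpoly" where
  "tmonomial a = prod_list (map (\<lambda>k. pw k (a k)) [1..<Suc m])"

lemma pw_in: "k \<in> {1..m} \<Longrightarrow> pw k x \<in> carrier TA"
  using t_in[of k] t'_in[of k] by (auto simp: pw_def intro: free_alg_power)

lemma tmonomial_in: "tmonomial a \<in> carrier TA"
  unfolding tmonomial_def by (intro free_alg_prod_list) (auto simp: pw_in simp del: upt_Suc)

lemma tpow_eq: "k \<in> {1..m} \<Longrightarrow> tpow A d ws k x = tclass A d ws (pw k x)"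
  using t_in[of k] t'_in[of k] by (auto simp: tpow_def pw_def tclass_power)

lemma tmon_eq:
  "\<exists>b. b \<noteq> 0 \<and> tmon A d ws a = tclass A d ws (Const b * tmonomial a)"
proof -
  have "oprod (torus A d ws) (\<lambda>k. tpow A d ws k (a k)) m = oprod (torus A d ws) (\<lambda>k. tclass A d ws (pw k (a k))) m"
    unfolding oprod_def by (intro foldr_cong refl) (simp add: tpow_eq del: upt_Suc)
  also have "\<dots> = tclass A d ws (tmonomial a)"
    unfolding tmonomial_def by (intro tclass_oprod pw_in)
  finally show ?thesis
    unfolding tmon_def by (intro exI conjI; (subst tclass_mult)?) (auto intro: tmonomial_in free_alg_Const)
qed

lemma pw_add1: "k \<in> {1..m} \<Longrightarrow> t k * pw k x \<approx> pw k (x + 1)"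
proof (cases "x \<ge> 0")
  case True
  then show ?thesis by (simp add: pw_def nat_add_distrib)
next
  case False
  assume k: "k \<in> {1..m}"
  define n where "n = nat (- x - 1)"
  have n: "x = - int (Suc n)" using False by (simp add: n_def)
  have "t k * pw k x = t k * t' k * t' k ^ n" by (simp add: pw_def n nat_add_distrib mult.assoc)
  also have "\<dots> \<approx> 1 * t' k ^ n" by (rule congr_rmult[OF t_t'[OF k]])
  also have "1 * t' k ^ n = pw k (x + 1)" by (simp add: pw_def n)
  finally show ?thesis .
qed

lemma pw_diff1: "k \<in> {1..m} \<Longrightarrow> t' k * pw k x \<approx> pw k (x - 1)"
proof (cases "x \<le> 0")
  case True
  then show ?thesis by (cases "x = 0") (auto simp: pw_def nat_diff_distrib Suc_nat_eq_nat_zadd1 simp flip: power_Suc)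
next
  case False
  assume k: "k \<in> {1..m}"
  define n where "n = nat (x - 1)"
  have n: "x = int (Suc n)" using False by (simp add: n_def)
  have "t' k * pw k x = t' k * t k * t k ^ n" by (simp add: pw_def n nat_add_distrib mult.assoc)
  also have "\<dots> \<approx> 1 * t k ^ n" by (rule congr_rmult[OF t'_t[OF k]])
  also have "1 * t k ^ n = pw k (x - 1)" by (simp add: pw_def n)
  finally show ?thesis .
qed

lemma pw_0 [simp]: "pw k 0 = 1" and pw_1 [simp]: "pw k 1 = t k"
  by (simp_all add: pw_def)

lemma pw_mult: "k \<in> {1..m} \<Longrightarrow> pw k x * pw k y \<approx> pw k (x + y)"
proof (induction x rule: int_induct[where k = 0])
  case (step1 x)
  have "pw k (x + 1) * pw k y \<approx> t k * pw k x * pw k y"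
    by (rule congr_rmult[OF congr_sym[OF pw_add1[OF step1(3)]]])
  also have "\<dots> = t k * (pw k x * pw k y)" by (simp add: mult.assoc)
  also have "\<dots> \<approx> t k * pw k (x + y)" by (intro congr_lmult step1)
  also have "\<dots> \<approx> pw k (x + y + 1)" by (rule pw_add1[OF step1(3)])
  finally show ?case by (simp add: algebra_simps)
next
  case (step2 x)
  have "pw k (x - 1) * pw k y \<approx> t' k * pw k x * pw k y"
    by (rule congr_rmult[OF congr_sym[OF pw_diff1[OF step2(3)]]])
  also have "\<dots> = t' k * (pw k x * pw k y)" by (simp add: mult.assoc)
  also have "\<dots> \<approx> t' k * pw k (x + y)" by (intro congr_lmult step2)
  also have "\<dots> \<approx> pw k (x + y - 1)" by (rule pw_diff1[OF step2(3)])
  finally show ?case by (simp add: algebra_simps)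
qed simp

lemma qcomm_pw_right:
  assumes "k \<in> {1..m}" "qcomm u f (t k)"
  shows "qcomm (u powi x) f (pw k x)"
proof (cases "x \<ge> 0")
  case True
  then show ?thesis using qcomm_power_right[OF assms(2), of "nat x"] by (simp add: pw_def power_int_def)
next
  case False
  have "qcomm (inverse u) f (t' k)"
    by (rule qcomm_inverse_right[OF assms(2) t_t' t'_t]) (use assms in auto)
  then show ?thesis using False qcomm_power_right[of "inverse u" f "t' k" "nat (- x)"]
    by (simp add: pw_def power_int_def)
qed

text \<open>The skew form of the quantum torus: the exponent of \<open>q\<close> produced when
  \<open>t l\<close> moves past \<open>t k\<close>.\<close>

definition comm_form :: "nat \<Rightarrow> nat \<Rightarrow> int" where
  "comm_form l k = (if k < l then c (letter ws k) (letter ws l) else if l < k then - c (letter ws k) (letter ws l) else 0)"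

lemma qcomm_t_t:
  assumes "k \<in> {1..m}" "l \<in> {1..m}"
  shows "qcomm (qpar powi comm_form l k) (t l) (t k)"
proof (cases "l < k")
  case True
  then have "qcomm (inverse (qpar powi c (letter ws l) (letter ws k))) (t l) (t k)"
    using assms by (intro qcomm_sym t_qcomm) auto
  then show ?thesis
    using True c_sym[OF letter_in[OF assms(1)] letter_in[OF assms(2)]] by (simp add: comm_form_def power_int_minus)
next
  case False
  then show ?thesis using assms t_qcomm[of k l] by (auto simp: comm_form_def qcomm_refl)
qed

definition comm_exp :: "nat \<Rightarrow> (nat \<Rightarrow> int) \<Rightarrow> int" where
  "comm_exp l a = (\<Sum>k=1..m. comm_form l k * a k)"

lemma qcomm_t_tmonomial:
  assumes "l \<in> {1..m}"
  shows "qcomm (qpar powi comm_exp l a) (t l) (tmonomial a)"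
proof -
  have "qcomm (qpar powi (comm_form l k * a k)) (t l) (pw k (a k))" if "k \<in> {1..m}" for k
    using qcomm_pw_right[OF that qcomm_t_t[OF that assms]] by (simp add: power_int_mult)
  then have "qcomm (prod_list (map (\<lambda>k. qpar powi (comm_form l k * a k)) [1..<Suc m])) (t l) (tmonomial a)"
    unfolding tmonomial_def by (intro qcomm_prod_list_right) (auto simp del: upt_Suc)
  then show ?thesis
    by (subst (asm) prod_list_powi) (simp_all add: comm_exp_def atLeastLessThanSuc_atLeastAtMost del: upt_Suc)
qed

lemma tmonomial_add: "tmonomial a * tmonomial b \<sim> tmonomial (\<lambda>k. a k + b k)"
proof -
  have pw_comm: "pw k x * pw l y \<sim> pw l y * pw k x" if "k \<in> {1..m}" "l \<in> {1..m}" for k l x y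
    using qcomm_pw_right[OF that(2) qcomm_sym[OF qcomm_pw_right[OF that(1) qcomm_t_t[OF that]]]]
    by (rule scong_of_qcomm)
  have pointwise: "prod_list (map (\<lambda>k. pw k (a k) * pw k (b k)) ks) \<sim> prod_list (map (\<lambda>k. pw k (a k + b k)) ks)"
    if "set ks \<subseteq> {1..m}" for ks
    using that by (induction ks) (auto intro!: scong_mult[OF scong_of_congr[OF pw_mult]])
  have "tmonomial a * tmonomial b \<sim> prod_list (map (\<lambda>k. pw k (a k) * pw k (b k)) [1..<Suc m])"
    unfolding tmonomial_def by (intro scong_prod_list_mult pw_comm) auto
  also have "\<dots> \<sim> tmonomial (\<lambda>k. a k + b k)"
    unfolding tmonomial_def by (rule pointwise) auto
  finally show ?thesis .
qed

lemma tmonomial_0: "tmonomial (\<lambda>k. 0) = 1"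
  unfolding tmonomial_def by (simp add: map_replicate_const prod_list_replicate del: upt_Suc)

lemma tmonomial_single: "k \<in> {1..m} \<Longrightarrow> tmonomial (\<lambda>j. if j = k then 1 else 0) = t k"
proof -
  assume "k \<in> {1..m}"
  moreover have "(\<lambda>j. pw j (if j = k then 1 else 0)) = (\<lambda>j. if j = k then t k else 1)"
    by auto
  ultimately show ?thesis unfolding tmonomial_def by (simp add: prod_list_indicator del: upt_Suc)
qed

lemma tmonomial_power: "tmonomial a ^ e \<sim> tmonomial (\<lambda>k. int e * a k)"
proof (induction e)
  case 0
  then show ?case by (simp add: tmonomial_0)
next
  case (Suc e)
  have "tmonomial a ^ Suc e \<sim> tmonomial a * tmonomial (\<lambda>k. int e * a k)"
    using Suc by (auto intro: scong_mult)
  also have "\<dots> \<sim> tmonomial (\<lambda>k. a k + int e * a k)" by (rule tmonomial_add)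
  finally show ?case by (simp add: algebra_simps)
qed

lemma scong_power: "f \<sim> g \<Longrightarrow> f ^ e \<sim> g ^ e"
  by (induction e) (auto intro: scong_mult)

lemma tmonomial_prod_list:
  assumes "\<And>j. j \<in> set js \<Longrightarrow> f j \<sim> tmonomial (a j)" "distinct js"
  shows "prod_list (map f js) \<sim> tmonomial (\<lambda>k. \<Sum>j\<in>set js. a j k)"
  using assms
proof (induction js)
  case (Cons j js)
  have "prod_list (map f (j # js)) \<sim> tmonomial (a j) * tmonomial (\<lambda>k. \<Sum>j\<in>set js. a j k)"
    using Cons by (auto intro: scong_mult)
  also have "\<dots> \<sim> tmonomial (\<lambda>k. a j k + (\<Sum>j\<in>set js. a j k))" by (rule tmonomial_add)
  finally show ?case using Cons.prems by simp
qed (simp add: tmonomial_0)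

section \<open>Monomials in the image\<close>

text \<open>The preimage \<open>g\<close> may contain letters outside \<open>I\<close>. Since
  \<open>sigma\<close> vanishes on them, \<open>mono_image_realize\<close> can replace
  \<open>g\<close> by its retraction.\<close>

definition in_image :: "(tgen, 'k qfield) ncpoly \<Rightarrow> bool" where
  "in_image f \<longleftrightarrow> (\<exists>g. subst sigma g \<approx> f)"

lemma in_image_sigma: "in_image (sigma j)"
  unfolding in_image_def by (rule exI[of _ "Var j"]) simp

lemma in_image_mult: "in_image f \<Longrightarrow> in_image g \<Longrightarrow> in_image (f * g)"
  unfolding in_image_def by (metis congr_mult subst_mult)

lemma in_image_diff: "in_image f \<Longrightarrow> in_image g \<Longrightarrow> in_image (f - g)"
  unfolding in_image_def by (metis congr_diff subst_diff)

lemma in_image_Const: "in_image (Const b)"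
  unfolding in_image_def by (rule exI[of _ "Const b"]) simp

lemma in_image_congr: "in_image f \<Longrightarrow> f \<approx> g \<Longrightarrow> in_image g"
  unfolding in_image_def by (metis congr_trans)

lemma in_image_scong: assumes "in_image f" "f \<sim> g" shows "in_image g"
proof -
  obtain b where "g \<approx> Const b * f" using scong_sym[OF assms(2)] by (auto simp: scong_def)
  then show ?thesis using in_image_congr[OF in_image_mult[OF in_image_Const assms(1)] congr_sym] by blast
qed

definition mono_image :: "(nat \<Rightarrow> int) \<Rightarrow> bool" where
  "mono_image a \<longleftrightarrow> in_image (tmonomial a)"

lemma mono_image_add: "mono_image a \<Longrightarrow> mono_image b \<Longrightarrow> mono_image (\<lambda>k. a k + b k)"
  unfolding mono_image_def by (rule in_image_scong[OF in_image_mult tmonomial_add])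

lemma sigma_pair:
  assumes "{k \<in> {1..m}. letter ws k = j} = {p, r}" "p < r"
  shows "sigma j = t p + t r"
  unfolding sigma_def assms(1) using assms(2) by simp

text \<open>A \<open>q\<close>-commutator of \<open>x\<^sub>j\<close> with a monomial, twisted so that the contribution of \<open>t\<^sub>r\<close> cancels,
  is a monomial again.\<close>

lemma mono_image_move:
  assumes "p \<in> {1..m}" "r \<in> {1..m}" "sigma j = t p + t r" "comm_exp p a \<noteq> comm_exp r a" "mono_image a"
  shows "mono_image (\<lambda>k. a k + (if k = p then 1 else 0))"
proof -
  let ?q = "\<lambda>l. qpar powi comm_exp l a :: 'k qfield"
  have "sigma j * tmonomial a - Const (?q r) * (tmonomial a * sigma j) \<approx>
      (Const (?q p) * (tmonomial a * t p) + Const (?q r) * (tmonomial a * t r)) - Const (?q r) * (tmonomial a * sigma j)"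
    unfolding assms(3) distrib_right using assms
    by (intro congr_diff congr_add congr_refl qcommD qcomm_t_tmonomial)
  also have "\<dots> = Const (?q p - ?q r) * (tmonomial a * t p)"
    by (simp add: assms(3) Const_diff distrib_left left_diff_distrib)
  finally have "in_image (Const (?q p - ?q r) * (tmonomial a * t p))"
    by (rule in_image_congr[rotated]) (use assms(5) in \<open>auto simp: mono_image_def intro!: in_image_diff in_image_mult in_image_Const in_image_sigma\<close>)
  \<comment> \<open>Distinct exponents give distinct powers, as \<open>q\<close> is not a root of
    unity.\<close>
  moreover have "?q p - ?q r \<noteq> 0"
    using assms(4) powi_inj[OF not_root_of_unity_qpar, of "comm_exp p a" "comm_exp r a"] by auto
  ultimately have "in_image (tmonomial a * t p)"
    by (rule in_image_scong[OF _ scong_Const_mult])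
  then show ?thesis
    unfolding mono_image_def tmonomial_single[OF assms(1), symmetric] by (rule in_image_scong[OF _ tmonomial_add])
qed

text \<open>Form the \<open>q\<close>-commutator of \<open>sigma j'\<close> and
  \<open>sigma j\<close> with factor \<open>?u\<close>. In the order \<open>p < p' < r < r'\<close>,
  three of the four pairs have the letter \<open>j'\<close> after \<open>j\<close>, and their
  products cancel. The pair \<open>p'\<close>, \<open>r\<close> is in the opposite order and
  survives with coefficient \<open>1 - ?u * ?u\<close>, which is nonzero because
  \<open>c j j'\<close> is.\<close>

lemma mono_image_edge:
  assumes pos: "p \<in> {1..m}" "p < p'" "p' < r" "r < r'" "r' \<le> m"
    and sig: "sigma j = t p + t r" "sigma j' = t p' + t r'"
    and letters: "letter ws p = j" "letter ws r = j" "letter ws p' = j'" "letter ws r' = j'"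
    and c0: "c j j' \<noteq> 0"
  shows "mono_image (\<lambda>k. (if k = p' then 1 else 0) + (if k = r then 1 else 0))"
proof -
  let ?u = "qpar powi c j j' :: 'k qfield"
  have I: "j \<in> I" "j' \<in> I" using letter_in[of p] letter_in[of p'] pos letters by auto
  have 1: "t p' * t p \<approx> Const ?u * (t p * t p')" "t r' * t p \<approx> Const ?u * (t p * t r')"
      "t r' * t r \<approx> Const ?u * (t r * t r')" "t r * t p' \<approx> Const ?u * (t p' * t r)"
    using t_qcomm[of p p'] t_qcomm[of p r'] t_qcomm[of r r'] t_qcomm[of p' r] pos letters c_sym[OF I]
    by (auto intro!: qcommD)
  have "sigma j' * sigma j - Const ?u * (sigma j * sigma j') =
     (t p' * t p + (t p' * t r + (t r' * t p + t r' * t r))) -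
     (Const ?u * (t p * t p') + (Const ?u * (t r * t p') + (Const ?u * (t p * t r') + Const ?u * (t r * t r'))))"
    by (simp add: sig distrib_left distrib_right add.assoc)
  also have "\<dots> \<approx> (Const ?u * (t p * t p') + (t p' * t r + (Const ?u * (t p * t r') + Const ?u * (t r * t r')))) -
     (Const ?u * (t p * t p') + (Const ?u * (Const ?u * (t p' * t r)) + (Const ?u * (t p * t r') + Const ?u * (t r * t r'))))"
    by (intro congr_diff congr_add congr_refl congr_lmult 1)
  also have "\<dots> = Const (1 - ?u * ?u) * (t p' * t r)"
    by (simp add: Const_diff left_diff_distrib Const_mult_Const)
  finally have "in_image (Const (1 - ?u * ?u) * (t p' * t r))"
    by (rule in_image_congr[rotated]) (auto intro!: in_image_diff in_image_mult in_image_Const in_image_sigma)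
  moreover have "1 - ?u * ?u \<noteq> 0"
    using powi_inj[OF not_root_of_unity_qpar, of 0 "c j j' + c j j'"] c0
      power_int_add[of "qpar :: 'k qfield" "c j j'" "c j j'"] by auto
  ultimately have "in_image (t p' * t r)"
    by (rule in_image_scong[OF _ scong_Const_mult])
  then have "in_image (tmonomial (\<lambda>k. if k = p' then 1 else 0) * tmonomial (\<lambda>k. if k = r then 1 else 0))"
    using pos by (simp add: tmonomial_single)
  then show ?thesis
    unfolding mono_image_def by (rule in_image_scong[OF _ tmonomial_add])
qed

lemma mono_image_realize:
  assumes "mono_image a" "F \<sim> tmonomial a" "F \<in> carrier TA"
  shows "\<exists>Xt\<in>carrier U. Psi I A d ws Xt = tclass A d ws F"
proof -
  have "in_image F" using assms(1,2) scong_sym in_image_scong unfolding mono_image_def by blast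
  then obtain g where g: "subst sigma g \<approx> F" by (auto simp: in_image_def)
  have "sigma j = 0" if "j \<notin> I" for j
    using that letter_in by (auto simp: sigma_def intro!: sum.neutral)
  then have "subst sigma (retract I g) = subst sigma g" by (rule subst_retract)
  then have "Psi I A d ws (ucl (retract I g)) = tclass A d ws F"
    using tclass_eq[OF subst_sigma_in assms(3) g] by (simp add: Psi_ucl retract_in)
  then show ?thesis by (auto simp: carrier_U retract_in)
qed

text \<open>Reduces the product of a cluster variable with coefficients to one exponent vector. The
  product itself is kept exactly, as the class of \<open>F\<close>; scalars are ignored only when
  comparing \<open>F\<close> with the image.\<close>

lemma cluster_monomial_eq:
  fixes e :: "nat \<Rightarrow> nat"
  shows "\<exists>F\<in>carrier TA. F \<sim> tmonomial (\<lambda>p. x p + (\<Sum>j=1..n. int (e j) * y j p)) \<and>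
    tmon A d ws x \<otimes>\<^bsub>torus A d ws\<^esub>
      oprod (torus A d ws) (\<lambda>j. tmon A d ws (y j) [^]\<^bsub>torus A d ws\<^esub> e j) n = tclass A d ws F"
proof -
  obtain b where b: "b \<noteq> 0" "tmon A d ws x = tclass A d ws (Const b * tmonomial x)"
    using tmon_eq by blast
  have "\<forall>j. \<exists>b. b \<noteq> 0 \<and> tmon A d ws (y j) = tclass A d ws (Const b * tmonomial (y j))"
    using tmon_eq by blast
  then obtain b' where b': "\<And>j. b' j \<noteq> 0" "\<And>j. tmon A d ws (y j) = tclass A d ws (Const (b' j) * tmonomial (y j))"
    by metis
  let ?f = "\<lambda>j. (Const (b' j) * tmonomial (y j)) ^ e j"
  have f_in: "?f j \<in> carrier TA" for j by (intro free_alg_intros tmonomial_in)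
  let ?F = "(Const b * tmonomial x) * prod_list (map ?f [1..<Suc n])"
  have "oprod (torus A d ws) (\<lambda>j. tmon A d ws (y j) [^]\<^bsub>torus A d ws\<^esub> e j) n =
      tclass A d ws (prod_list (map ?f [1..<Suc n]))"
    unfolding b' by (subst tclass_power[symmetric]) (simp_all add: tclass_oprod f_in free_alg_mult free_alg_Const tmonomial_in del: upt_Suc)
  moreover have Pin: "prod_list (map ?f [1..<Suc n]) \<in> carrier TA"
    by (intro free_alg_prod_list) (auto simp: f_in simp del: upt_Suc)
  ultimately have "tmon A d ws x \<otimes>\<^bsub>torus A d ws\<^esub>
      oprod (torus A d ws) (\<lambda>j. tmon A d ws (y j) [^]\<^bsub>torus A d ws\<^esub> e j) n = tclass A d ws ?F"
    using b tclass_mult[OF free_alg_mult[OF free_alg_Const tmonomial_in] Pin] by simp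
  moreover have "?F \<in> carrier TA" by (intro free_alg_mult free_alg_Const tmonomial_in Pin)
  moreover have "?F \<sim> tmonomial (\<lambda>p. x p + (\<Sum>j=1..n. int (e j) * y j p))"
  proof -
    have "?f j \<sim> tmonomial (\<lambda>p. int (e j) * y j p)" for j
      by (rule scong_trans[OF scong_power[OF scong_Const_mult[OF b'(1)]] tmonomial_power])
    then have "prod_list (map ?f [1..<Suc n]) \<sim> tmonomial (\<lambda>p. \<Sum>j\<in>set [1..<Suc n]. int (e j) * y j p)"
      by (intro tmonomial_prod_list) auto
    then have "?F \<sim> tmonomial x * tmonomial (\<lambda>p. \<Sum>j\<in>set [1..<Suc n]. int (e j) * y j p)"
      by (rule scong_mult[OF scong_Const_mult[OF b(1)]])
    also have "\<dots> \<sim> tmonomial (\<lambda>p. x p + (\<Sum>j\<in>set [1..<Suc n]. int (e j) * y j p))" by (rule tmonomial_add)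
    finally show ?thesis by (simp add: atLeastLessThanSuc_atLeastAtMost del: upt_Suc)
  qed
  ultimately show ?thesis by blast
qed

end

section \<open>Combinatorics of the exponents\<close>

abbreviation unitv :: "nat \<Rightarrow> nat \<Rightarrow> int" where
  "unitv k \<equiv> (\<lambda>l. if l = k then 1 else 0)"

text \<open>For the doubled word this is minus the entry of \<open>phi\<close> at \<open>p\<close>
  (see \<open>phi_left\<close>). Up to a positive factor it is also the difference of the
  commutation exponents of \<open>t (n + p)\<close> and \<open>t p\<close> (see
  \<open>comm_exp_diff\<close>).\<close>

definition gap :: "nat \<Rightarrow> (nat \<Rightarrow> nat \<Rightarrow> int) \<Rightarrow> (nat \<Rightarrow> int) \<Rightarrow> nat \<Rightarrow> int" where
  "gap n B a p = a p + a (n + p) + (\<Sum>k\<in>{p<..n}. B p k * a k) + (\<Sum>k\<in>{1..<p}. B p k * a (n + k))"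

text \<open>For the doubled word this is minus the entry of \<open>phi\<close> at
  \<open>n + p\<close>, see \<open>phi_right\<close>; it becomes the exponent of the coefficient
  \<open>C_p\<close>.\<close>

definition frozen_deg :: "nat \<Rightarrow> (nat \<Rightarrow> nat \<Rightarrow> int) \<Rightarrow> (nat \<Rightarrow> int) \<Rightarrow> nat \<Rightarrow> int" where
  "frozen_deg n B a p = a (n + p) + (\<Sum>k\<in>{p<..n}. B p k * a (n + k))"

lemma gap_add: "gap n B (\<lambda>k. a k + b k) p = gap n B a p + gap n B b p"
  by (simp add: gap_def distrib_left sum.distrib)

lemma frozen_deg_add: "frozen_deg n B (\<lambda>k. a k + b k) p = frozen_deg n B a p + frozen_deg n B b p"
  by (simp add: frozen_deg_def distrib_left sum.distrib)

lemma mult_unitv: "x * unitv k l = (if l = k then x else 0)"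
  by simp

lemma gap_unitv_left:
  assumes "k \<in> {1..n}" "p \<in> {1..n}"
  shows "gap n B (unitv k) p = (if k = p then 1 else if p < k then B p k else 0)"
proof -
  have "(\<Sum>l\<in>{1..<p}. B p l * unitv k (n + l)) = 0"
    using assms by (intro sum.neutral) auto
  moreover have "(\<Sum>l\<in>{p<..n}. B p l * unitv k l) = (if p < k then B p k else 0)"
    using assms by (simp only: mult_unitv) simp
  ultimately show ?thesis using assms by (auto simp: gap_def)
qed

lemma gap_unitv_right:
  assumes "k \<in> {1..n}" "p \<in> {1..n}"
  shows "gap n B (unitv (n + k)) p = (if k = p then 1 else if k < p then B p k else 0)"
proof -
  have "(\<Sum>l\<in>{p<..n}. B p l * unitv (n + k) l) = 0"
    using assms by (intro sum.neutral) auto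
  moreover have "(\<Sum>l\<in>{1..<p}. B p l * unitv (n + k) (n + l)) = (\<Sum>l\<in>{1..<p}. if l = k then B p l else 0)"
    by (intro sum.cong) auto
  ultimately show ?thesis using assms by (auto simp: gap_def)
qed

lemma frozen_deg_unitv_left: "k \<in> {1..n} \<Longrightarrow> p \<in> {1..n} \<Longrightarrow> frozen_deg n B (unitv k) p = 0"
  by (simp add: frozen_deg_def)

lemma frozen_deg_unitv_right:
  assumes "k \<in> {1..n}" "p \<in> {1..n}"
  shows "frozen_deg n B (unitv (n + k)) p = (if k = p then 1 else if p < k then B p k else 0)"
proof -
  have "(\<Sum>l\<in>{p<..n}. B p l * unitv (n + k) (n + l)) = (\<Sum>l\<in>{p<..n}. if l = k then B p l else 0)"
    by (intro sum.cong) auto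
  then show ?thesis using assms by (auto simp: frozen_deg_def)
qed

text \<open>Off the diagonal, the submatrix along the list is the Cartan matrix of type
  \<open>A_r\<close> in its linear numbering.\<close>

fun linear_chain :: "('x \<Rightarrow> 'x \<Rightarrow> int) \<Rightarrow> 'x list \<Rightarrow> bool" where
  "linear_chain C [] \<longleftrightarrow> True"
| "linear_chain C [x] \<longleftrightarrow> True"
| "linear_chain C (x # y # zs) \<longleftrightarrow> C x y = - 1 \<and> C y x = - 1 \<and>
     (\<forall>z\<in>set zs. C x z = 0 \<and> C z x = 0) \<and> linear_chain C (y # zs)"

text \<open>Retains only closure properties of the set of exponents whose monomials lie in the
  image, so that the rest is integer combinatorics.\<close>

locale monomial_moves =
  fixes n :: nat and B :: "nat \<Rightarrow> nat \<Rightarrow> int" and M :: "(nat \<Rightarrow> int) \<Rightarrow> bool"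
  assumes B_nonpos: "p \<in> {1..n} \<Longrightarrow> k \<in> {1..n} \<Longrightarrow> p \<noteq> k \<Longrightarrow> B p k \<le> 0"
    and B_zero_sym: "p \<in> {1..n} \<Longrightarrow> k \<in> {1..n} \<Longrightarrow> B p k = 0 \<longleftrightarrow> B k p = 0"
    and M_add: "M a \<Longrightarrow> M b \<Longrightarrow> M (\<lambda>k. a k + b k)"
    and M_left: "k \<in> {1..n} \<Longrightarrow> M a \<Longrightarrow> gap n B a k \<noteq> 0 \<Longrightarrow> M (\<lambda>l. a l + unitv k l)"
    and M_right: "k \<in> {1..n} \<Longrightarrow> M a \<Longrightarrow> gap n B a k \<noteq> 0 \<Longrightarrow> M (\<lambda>l. a l + unitv (n + k) l)"
    and M_edge: "k \<in> {1..n} \<Longrightarrow> j \<in> {1..n} \<Longrightarrow> k < j \<Longrightarrow> B k j \<noteq> 0 \<Longrightarrow> M (\<lambda>l. unitv j l + unitv (n + k) l)"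
begin

abbreviation "g \<equiv> gap n B"
abbreviation "h \<equiv> frozen_deg n B"

text \<open>In terms of \<open>phi\<close>, the entries at positions up to \<open>n\<close> are
  nonnegative. Nonnegativity of \<open>a\<close> itself serves to find an edge in
  \<open>make_frozen_deg_nonneg\<close>.\<close>

definition good :: "(nat \<Rightarrow> int) \<Rightarrow> bool" where
  "good a \<longleftrightarrow> M a \<and> a \<in> zlattice (2 * n) \<and> (\<forall>k. a k \<ge> 0) \<and> (\<forall>p\<in>{1..n}. g a p \<le> 0)"

lemma good_add: "good a \<Longrightarrow> good b \<Longrightarrow> good (\<lambda>k. a k + b k)"
  unfolding good_def by (fastforce simp: gap_add zlattice_def intro: M_add add_nonpos_nonpos)

text \<open>The gap at \<open>k\<close> rises by one, which its bound \<open>- 1\<close> permits;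
  the other gaps change by zero or an off-diagonal Cartan entry, so they do not rise.\<close>

lemma good_left:
  assumes "k \<in> {1..n}" "good a" "g a k \<le> - 1"
  shows "good (\<lambda>l. a l + unitv k l)"
proof -
  have "g (\<lambda>l. a l + unitv k l) p \<le> 0" if "p \<in> {1..n}" for p
    using assms that B_nonpos[of p k]
    by (auto simp: good_def gap_add gap_unitv_left intro: add_nonpos_nonpos)
  moreover have "(\<lambda>l. a l + unitv k l) \<in> zlattice (2 * n)"
    using assms by (auto simp: good_def zlattice_def)
  moreover have "\<forall>l. a l + unitv k l \<ge> 0"
    using assms by (auto simp: good_def)
  ultimately show ?thesis using M_left[of k a] assms by (simp add: good_def)
qed

lemma good_right:
  assumes "k \<in> {1..n}" "good a" "g a k \<le> - 1"
  shows "good (\<lambda>l. a l + unitv (n + k) l)"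
proof -
  have "g (\<lambda>l. a l + unitv (n + k) l) p \<le> 0" if "p \<in> {1..n}" for p
    using assms that B_nonpos[of p k]
    by (auto simp: good_def gap_add gap_unitv_right intro: add_nonpos_nonpos)
  moreover have "(\<lambda>l. a l + unitv (n + k) l) \<in> zlattice (2 * n)"
    using assms by (auto simp: good_def zlattice_def)
  moreover have "\<forall>l. a l + unitv (n + k) l \<ge> 0"
    using assms by (auto simp: good_def)
  ultimately show ?thesis using M_right[of k a] assms by (simp add: good_def)
qed

text \<open>The starting monomials of the argument, provided by
  \<open>mono_image_edge\<close>.\<close>

definition edge :: "nat \<Rightarrow> nat \<Rightarrow> nat \<Rightarrow> int" where
  "edge k j = (\<lambda>l. unitv j l + unitv (n + k) l)"

lemma gap_edge:
  assumes "k \<in> {1..n}" "j \<in> {1..n}" "k < j" "p \<in> {1..n}"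
  shows "g (edge k j) p = (if p = j then 1 else if p < j then B p j else 0) + (if p = k then 1 else if k < p then B p k else 0)"
  using assms unfolding edge_def gap_add by (simp add: gap_unitv_left gap_unitv_right)

lemma frozen_deg_edge:
  assumes "k \<in> {1..n}" "j \<in> {1..n}" "p \<in> {1..n}"
  shows "h (edge k j) p = (if k = p then 1 else if p < k then B p k else 0)"
  using assms unfolding edge_def frozen_deg_add by (simp add: frozen_deg_unitv_left frozen_deg_unitv_right)

text \<open>At \<open>k\<close> and \<open>j\<close> the gap is one plus a nonzero off-diagonal
  Cartan entry; at other positions it is a sum of such entries or zero.\<close>

lemma good_edge:
  assumes "k \<in> {1..n}" "j \<in> {1..n}" "k < j" "B k j \<noteq> 0"
  shows "good (edge k j)"
proof -
  have neg: "B k j \<le> - 1" "B j k \<le> - 1"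
    using assms B_nonpos[of k j] B_nonpos[of j k] B_zero_sym[of k j] by auto
  have "g (edge k j) p \<le> 0" if p: "p \<in> {1..n}" for p
    unfolding gap_edge[OF assms(1-3) p]
    using neg assms(3) B_nonpos[OF p assms(1)] B_nonpos[OF p assms(2)] by auto
  then show ?thesis
    using assms M_edge[OF assms] by (auto simp: good_def edge_def zlattice_def)
qed

section \<open>Propagation of positive entries of \<open>phi\<close> along the diagram\<close>

definition low :: "nat \<Rightarrow> bool" where
  "low p \<longleftrightarrow> (\<exists>a. good a \<and> g a p \<le> - 1)"

text \<open>A unit at \<open>p\<close> may be added to the witness without losing goodness. Placed
  in the first copy if \<open>l < p\<close> and in the second if \<open>p < l\<close>, it lowers the
  gap at \<open>l\<close> by at least one.\<close>

lemma low_adj: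
  assumes "p \<in> {1..n}" "l \<in> {1..n}" "low p" "l \<noteq> p" "B l p \<noteq> 0"
  shows "low l"
proof -
  obtain a where a: "good a" "g a p \<le> - 1" using assms by (auto simp: low_def)
  have B: "B l p \<le> - 1" using B_nonpos[of l p] assms by auto
  have gl: "g a l \<le> 0" using a assms by (auto simp: good_def)
  show ?thesis
  proof (cases "l < p")
    case True
    then have "g (\<lambda>k. a k + unitv p k) l \<le> - 1"
      using assms B gl by (simp add: gap_add gap_unitv_left)
    then show ?thesis using good_left[OF assms(1) a] by (auto simp: low_def)
  next
    case False
    then have "g (\<lambda>k. a k + unitv (n + p) k) l \<le> - 1"
      using assms B gl by (simp add: gap_add gap_unitv_right)
    then show ?thesis using good_right[OF assms(1) a] by (auto simp: low_def)
  qed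
qed

text \<open>By \<open>low_adj\<close>, both ends and all their neighbours fail to be low, so the
  gaps of \<open>edge k j\<close> are nonnegative there. This forces the bond to be simple, and a
  further smaller neighbour of \<open>j\<close> or larger neighbour of \<open>k\<close> would have a
  negative gap.\<close>

lemma not_low_edge:
  assumes kj: "k \<in> {1..n}" "j \<in> {1..n}" "k < j" "B k j \<noteq> 0" and "\<not> low k \<or> \<not> low j"
  shows "B k j = - 1" "B j k = - 1" "\<not> low k" "\<not> low j"
    "\<And>l. l \<in> {1..n} \<Longrightarrow> l < j \<Longrightarrow> B l j \<noteq> 0 \<Longrightarrow> l = k"
    "\<And>l. l \<in> {1..n} \<Longrightarrow> k < l \<Longrightarrow> B l k \<noteq> 0 \<Longrightarrow> l = j"
proof -
  have Bjk: "B j k \<noteq> 0" using kj B_zero_sym[of k j] by auto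
  have nl: "\<not> low k" "\<not> low j"
    using low_adj[of k j] low_adj[of j k] kj Bjk assms(5) by auto
  then show "\<not> low k" "\<not> low j" .
  \<comment> \<open>Otherwise \<open>edge k j\<close> itself would witness that \<open>l\<close> is
    low.\<close>
  have ge: "g (edge k j) l \<ge> 0" if "\<not> low l" for l
    using that good_edge[OF kj] by (auto simp: low_def)
  show "B k j = - 1" "B j k = - 1"
    using ge[OF nl(1)] ge[OF nl(2)] kj Bjk B_nonpos[of k j] B_nonpos[of j k]
    by (auto simp: gap_edge)
  show "l = k" if l: "l \<in> {1..n}" "l < j" "B l j \<noteq> 0" for l
  proof (rule ccontr)
    assume "l \<noteq> k"
    have "\<not> low l" using low_adj[of l j] l kj nl B_zero_sym[of l j] by auto
    from ge[OF this] show False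
      using l kj \<open>l \<noteq> k\<close> B_nonpos[of l j] B_nonpos[of l k] by (auto simp: gap_edge split: if_splits)
  qed
  show "l = j" if l: "l \<in> {1..n}" "k < l" "B l k \<noteq> 0" for l
  proof (rule ccontr)
    assume "l \<noteq> j"
    have "\<not> low l" using low_adj[of l k] l kj nl B_zero_sym[of l k] by auto
    from ge[OF this] show False
      using l kj \<open>l \<noteq> j\<close> B_nonpos[of l j] B_nonpos[of l k] by (auto simp: gap_edge split: if_splits)
  qed
qed

lemma good_scaled_edge_add:
  assumes "good a" "good b"
  shows "good (\<lambda>k. a k + int e * b k)"
proof (induction e)
  case (Suc e)
  then show ?case using good_add[OF Suc assms(2)] by (simp add: algebra_simps)
qed (simp add: assms)

lemma gap_scale: "g (\<lambda>k. e * b k) p = e * g b p"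
  by (simp add: gap_def sum_distrib_left algebra_simps)

lemma frozen_deg_scale: "h (\<lambda>k. e * b k) p = e * h b p"
  by (simp add: frozen_deg_def sum_distrib_left algebra_simps)

lemma make_frozen_deg_nonneg:
  assumes "good a" "s \<le> n"
  shows "\<exists>a'. good a' \<and> (\<forall>p\<in>{1..n}. g a' p \<le> g a p) \<and> (\<forall>p\<in>{s<..n}. h a' p \<ge> 0)"
  using assms(2)
proof (induction rule: inc_induct)
  case base
  show ?case using assms(1) by auto
next
  case (step s)
  then obtain a1 where a1: "good a1" "\<forall>p\<in>{1..n}. g a1 p \<le> g a p" "\<forall>p\<in>{Suc s<..n}. h a1 p \<ge> 0"
    by auto
  have s: "Suc s \<in> {1..n}" using step by auto
  show ?case
  proof (cases "h a1 (Suc s) \<ge> 0")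
    case True
    have "h a1 p \<ge> 0" if "p \<in> {s<..n}" for p
      using that a1(3) True by (cases "p = Suc s") auto
    then show ?thesis using a1 by blast
  next
    case False
    have "\<exists>k\<in>{Suc s<..n}. B (Suc s) k \<noteq> 0"
    proof (rule ccontr)
      assume "\<not> ?thesis"
      then have "h a1 (Suc s) = a1 (n + Suc s)"
        by (auto simp: frozen_deg_def intro!: sum.neutral)
      then show False using False a1(1) by (simp add: good_def)
    qed
    then obtain k where k: "k \<in> {1..n}" "Suc s < k" "B (Suc s) k \<noteq> 0" by auto
    define e where "e = nat (- h a1 (Suc s))"
    define a2 where "a2 = (\<lambda>l. a1 l + int e * edge (Suc s) k l)"
    have ge: "good (edge (Suc s) k)" by (rule good_edge[OF s k(1,2,3)])
    have "good a2" unfolding a2_def by (rule good_scaled_edge_add[OF a1(1) ge])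
    moreover have "g a2 p \<le> g a p" if "p \<in> {1..n}" for p
    proof -
      have "int e * g (edge (Suc s) k) p \<le> 0"
        using ge that by (intro mult_nonneg_nonpos) (auto simp: good_def)
      then show ?thesis using a1(2) that unfolding a2_def gap_add gap_scale by force
    qed
    moreover have "h a2 p \<ge> 0" if "p \<in> {s<..n}" for p
    proof -
      have p: "p \<in> {1..n}" using that by auto
      show ?thesis
        unfolding a2_def frozen_deg_add frozen_deg_scale frozen_deg_edge[OF s k(1) p]
        using that a1(3) False by (cases "p = Suc s") (auto simp: e_def)
    qed
    ultimately show ?thesis by blast
  qed
qed

lemma raise_one:
  assumes "good a" "s \<in> {1..n}" "g a s \<le> x" "x \<le> 0"
  shows "\<exists>a'. good a' \<and> g a' s = x \<and> (\<forall>p\<in>{1..n}. p \<noteq> s \<longrightarrow> g a' p \<le> g a p) \<and>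
    (\<forall>p\<in>{s<..n}. g a' p = g a p) \<and> (\<forall>p\<in>{1..n}. h a' p = h a p)"
  using assms
proof (induction "nat (x - g a s)" arbitrary: a)
  case 0
  then show ?case by (intro exI[of _ a]) auto
next
  case (Suc e)
  let ?a = "\<lambda>l. a l + unitv s l"
  have "good ?a" using Suc by (intro good_left) auto
  moreover have gs: "g ?a s = g a s + 1" using Suc.prems by (simp add: gap_add gap_unitv_left)
  ultimately obtain a' where a': "good a'" "g a' s = x" "\<forall>p\<in>{1..n}. p \<noteq> s \<longrightarrow> g a' p \<le> g ?a p"
    "\<forall>p\<in>{s<..n}. g a' p = g ?a p" "\<forall>p\<in>{1..n}. h a' p = h ?a p"
  proof -
    have "e = nat (x - g ?a s)" "g ?a s \<le> x" using Suc.hyps(2) Suc.prems gs by auto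
    from Suc.hyps(1)[OF this(1) \<open>good ?a\<close> Suc.prems(2) this(2) Suc.prems(4)]
    show ?thesis using that by blast
  qed
  have "g ?a p \<le> g a p" if "p \<in> {1..n}" "p \<noteq> s" for p
    using that Suc.prems B_nonpos[of p s] by (simp add: gap_add gap_unitv_left)
  moreover have "g ?a p = g a p" if "p \<in> {s<..n}" for p
    using that Suc.prems by (simp add: gap_add gap_unitv_left)
  moreover have "h ?a p = h a p" if "p \<in> {1..n}" for p
    using that Suc.prems by (simp add: frozen_deg_add frozen_deg_unitv_left)
  ultimately show ?case using a' by (intro exI[of _ a']) (auto intro: order_trans)
qed

text \<open>Going from the last position to the first, \<open>raise_one\<close> never disturbs a gap
  already adjusted. The gap at \<open>i\<close> stays negative until its turn, so the value
  \<open>- 1\<close> can be reached there from below.\<close>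

lemma raise_all:
  assumes "good a" "i \<in> {1..n}" "g a i \<le> - 1" "s \<le> n"
  shows "\<exists>a'. good a' \<and> (\<forall>p\<in>{1..n}. h a' p = h a p) \<and> (i \<le> s \<longrightarrow> g a' i \<le> - 1) \<and>
    (\<forall>p\<in>{s<..n}. g a' p = - unitv i p)"
  using assms(4)
proof (induction rule: inc_induct)
  case base
  show ?case using assms by auto
next
  case (step s)
  then obtain a1 where a1: "good a1" "\<forall>p\<in>{1..n}. h a1 p = h a p" "i \<le> Suc s \<longrightarrow> g a1 i \<le> - 1"
    "\<forall>p\<in>{Suc s<..n}. g a1 p = - unitv i p" by auto
  have s: "Suc s \<in> {1..n}" using step by auto
  have "g a1 (Suc s) \<le> - unitv i (Suc s)"
    using a1 s by (auto simp: good_def)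
  from raise_one[OF a1(1) s this] have "\<exists>a'. good a' \<and> g a' (Suc s) = - unitv i (Suc s) \<and>
    (\<forall>p\<in>{1..n}. p \<noteq> Suc s \<longrightarrow> g a' p \<le> g a1 p) \<and>
    (\<forall>p\<in>{Suc s<..n}. g a' p = g a1 p) \<and> (\<forall>p\<in>{1..n}. h a' p = h a1 p)" by simp
  then obtain a2 where a2: "good a2" "g a2 (Suc s) = - unitv i (Suc s)"
    "\<forall>p\<in>{1..n}. p \<noteq> Suc s \<longrightarrow> g a2 p \<le> g a1 p"
    "\<forall>p\<in>{Suc s<..n}. g a2 p = g a1 p" "\<forall>p\<in>{1..n}. h a2 p = h a1 p" by blast
  have "g a2 i \<le> - 1" if "i \<le> s"
  proof -
    have "g a2 i \<le> g a1 i" using a2(3) assms(2) that by auto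
    then show ?thesis using a1(3) that by auto
  qed
  moreover have "g a2 p = - unitv i p" if "p \<in> {s<..n}" for p
    using that a2(2,4) a1(4) by (cases "p = Suc s") auto
  ultimately show ?case using a1(2) a2(1,5) by (intro exI[of _ a2]) auto
qed

lemma low_target:
  assumes "i \<in> {1..n}" "low i"
  shows "\<exists>a. M a \<and> a \<in> zlattice (2 * n) \<and> (\<forall>p\<in>{1..n}. g a p = - unitv i p \<and> h a p \<ge> 0)"
proof -
  obtain a where a: "good a" "g a i \<le> - 1" using assms(2) by (auto simp: low_def)
  obtain a1 where a1: "good a1" "\<forall>p\<in>{1..n}. g a1 p \<le> g a p" "\<forall>p\<in>{0<..n}. h a1 p \<ge> 0"
    using make_frozen_deg_nonneg[OF a(1), of 0] by auto
  have "g a1 i \<le> - 1" using a1(2) assms(1) a(2) by force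
  from raise_all[OF a1(1) assms(1) this, of 0]
  obtain a2 where "good a2" "\<forall>p\<in>{1..n}. h a2 p = h a1 p" "\<forall>p\<in>{0<..n}. g a2 p = - unitv i p"
    by auto
  then show ?thesis using a1(3) by (intro exI[of _ a2]) (auto simp: good_def)
qed

section \<open>Increasing paths of positions that are not low\<close>

fun chain :: "nat list \<Rightarrow> bool" where
  "chain [] \<longleftrightarrow> True"
| "chain [x] \<longleftrightarrow> x \<in> {1..n} \<and> \<not> low x"
| "chain (x # y # zs) \<longleftrightarrow> x \<in> {1..n} \<and> \<not> low x \<and> x < y \<and> B x y \<noteq> 0 \<and> chain (y # zs)"

lemma chain_set: "chain ks \<Longrightarrow> set ks \<subseteq> {1..n}"
  by (induction ks rule: chain.induct) auto

lemma chain_not_low: "chain ks \<Longrightarrow> p \<in> set ks \<Longrightarrow> \<not> low p"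
  by (induction ks rule: chain.induct) auto

lemma chain_sorted: "chain ks \<Longrightarrow> sorted_wrt (<) ks"
  by (induction ks rule: chain.induct) auto

lemma chain_length: "chain ks \<Longrightarrow> length ks \<le> n"
  using chain_sorted[of ks] chain_set[of ks] card_mono[of "{1..n}" "set ks"]
  by (simp add: strict_sorted_iff distinct_card)

lemma chain_snoc: "chain ks \<Longrightarrow> ks \<noteq> [] \<Longrightarrow> last ks < l \<Longrightarrow> B (last ks) l \<noteq> 0 \<Longrightarrow> l \<in> {1..n} \<Longrightarrow> \<not> low l \<Longrightarrow> chain (ks @ [l])"
  by (induction ks rule: chain.induct) auto

lemma chain_Cons: "chain ks \<Longrightarrow> ks \<noteq> [] \<Longrightarrow> l < hd ks \<Longrightarrow> B l (hd ks) \<noteq> 0 \<Longrightarrow> l \<in> {1..n} \<Longrightarrow> \<not> low l \<Longrightarrow> chain (l # ks)"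
  by (cases ks) auto

text \<open>By \<open>not_low_edge\<close>, consecutive members are each other's only neighbour on
  the facing side. Hence a chain continues only downward from its head or upward from its last
  member.\<close>

lemma chain_neighbour:
  assumes "chain ks" "p \<in> set ks" "l \<in> {1..n}" "l \<noteq> p" "B p l \<noteq> 0"
  shows "l \<in> set ks \<or> (p = hd ks \<and> l < p) \<or> (p = last ks \<and> p < l)"
  using assms
proof (induction ks rule: chain.induct)
  case (3 x y zs)
  have xy: "x \<in> {1..n}" "y \<in> {1..n}" "x < y" "B x y \<noteq> 0" "\<not> low x \<or> \<not> low y"
    using 3(2) chain_set[of "y # zs"] by auto
  show ?case
  proof (cases "p = x")
    case True
    then show ?thesis
      using not_low_edge(6)[OF xy, of l] 3(4-6) xy B_zero_sym[of p l] by auto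
  next
    case False
      have "l = x" if "p = y" "l < y"
        using not_low_edge(5)[OF xy, of l] 3(4-6) that xy B_zero_sym[of p l] by auto
      moreover have "l \<in> set (y # zs) \<or> (p = y \<and> l < p) \<or> (p = last (y # zs) \<and> p < l)"
        using False 3 by simp
      ultimately show ?thesis by auto
  qed
qed auto

text \<open>The bonds are simple by \<open>not_low_edge\<close>, and a bond from \<open>x\<close> to
  a member beyond \<open>y\<close> would be a second larger neighbour of \<open>x\<close>.\<close>

lemma chain_imp_linear_chain: "chain ks \<Longrightarrow> linear_chain B ks"
proof (induction ks rule: chain.induct)
  case (3 x y zs)
  have xy: "x \<in> {1..n}" "y \<in> {1..n}" "x < y" "B x y \<noteq> 0" "\<not> low x \<or> \<not> low y"
    using 3(2) chain_set[of "y # zs"] by auto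
  have "B z x = 0 \<and> B x z = 0" if "z \<in> set zs" for z
  proof -
    have "z \<in> {1..n}" "y < z" using that 3(2) chain_set[of "y # zs"] chain_sorted[of "y # zs"] by auto
    then show ?thesis using not_low_edge(6)[OF xy, of z] xy B_zero_sym[of x z] by auto
  qed
  then show ?case using 3 not_low_edge(1,2)[OF xy] by auto
qed auto

text \<open>Chains have length at most \<open>n\<close>, so a longest one exists. A neighbour
  outside is not low by \<open>low_adj\<close> and would extend it at one end.\<close>

lemma maximal_chain:
  assumes "i \<in> {1..n}" "\<not> low i"
  shows "\<exists>ks. ks \<noteq> [] \<and> set ks \<subseteq> {1..n} \<and> sorted_wrt (<) ks \<and> linear_chain B ks \<and>
    (\<forall>p\<in>set ks. \<forall>l\<in>{1..n} - set ks. B p l = 0)"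
proof -
  let ?P = "\<lambda>ks. ks \<noteq> [] \<and> chain ks"
  obtain ks where ks: "?P ks" "\<And>ks'. ?P ks' \<Longrightarrow> length ks' \<le> length ks"
    using ex_has_greatest_nat[of ?P "[i]" length "Suc n"] assms chain_length by (auto simp: le_imp_less_Suc)
  have "B p l = 0" if pl: "p \<in> set ks" "l \<in> {1..n} - set ks" for p l
  proof (rule ccontr)
    assume nz: "B p l \<noteq> 0"
    have p: "p \<in> {1..n}" "\<not> low p" using pl ks(1) chain_set chain_not_low by blast+
    have "\<not> low l" using low_adj[of l p] p pl nz by auto
    moreover have "B l p \<noteq> 0" using B_zero_sym[of p l] nz p pl by auto
    ultimately have "chain (l # ks) \<or> chain (ks @ [l])"
      using chain_neighbour[of ks p l] chain_Cons[of ks l] chain_snoc[of ks l] ks(1) pl nz by auto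
    then show False using ks(2)[of "l # ks"] ks(2)[of "ks @ [l]"] by auto
  qed
  then show ?thesis
    using ks(1) chain_set chain_sorted chain_imp_linear_chain by blast
qed

end

section \<open>Reflections, and the automorphism \<open>\<phi>\<close>\<close>

locale weyl_action =
  fixes I :: "'i set" and A :: "'i \<Rightarrow> 'i \<Rightarrow> int"
  assumes fin: "finite I" and diag: "\<And>i. i \<in> I \<Longrightarrow> A i i = 2"
begin

abbreviation "s \<equiv> simple_refl I A"
abbreviation "W \<equiv> weyl_prod I A"

text \<open>The value of the simple coroot of \<open>i\<close> on the lattice vector
  \<open>v\<close>.\<close>

definition pairing :: "'i \<Rightarrow> ('i \<Rightarrow> int) \<Rightarrow> int" where
  "pairing i v = (\<Sum>j\<in>I. A i j * v j)"

text \<open>A reflection changes a single coordinate, so this rule reduces the involution,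
  commutation and braid relations to arithmetic in few coordinates.\<close>

lemma pairing_upd:
  assumes "k \<in> I"
  shows "pairing i (v(k := x)) = pairing i v + A i k * (x - v k)"
proof -
  have "pairing i (v(k := x)) = A i k * x + (\<Sum>j\<in>I - {k}. A i j * (v(k := x)) j)"
    unfolding pairing_def using fin assms by (subst sum.remove[of I k]) auto
  also have "(\<Sum>j\<in>I - {k}. A i j * (v(k := x)) j) = (\<Sum>j\<in>I - {k}. A i j * v j)"
    by (intro sum.cong) auto
  also have "\<dots> = pairing i v - A i k * v k"
    unfolding pairing_def using fin assms by (simp add: sum.remove[of I k])
  finally show ?thesis by (simp add: algebra_simps del: fun_upd_apply)
qed

lemma simple_refl_eq: "s i v = v(i := v i - pairing i v)"
  by (simp add: simple_refl_def pairing_def)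

lemma refl_involution: "i \<in> I \<Longrightarrow> s i (s i v) = v"
  by (simp add: simple_refl_eq pairing_upd diag)

lemma refl_commute: "i \<in> I \<Longrightarrow> j \<in> I \<Longrightarrow> A i j = 0 \<Longrightarrow> A j i = 0 \<Longrightarrow> s i (s j v) = s j (s i v)"
  by (cases "i = j") (auto simp: simple_refl_eq pairing_upd fun_upd_twist)

lemma refl_braid:
  "i \<in> I \<Longrightarrow> j \<in> I \<Longrightarrow> A i j = - 1 \<Longrightarrow> A j i = - 1 \<Longrightarrow> s i (s j (s i v)) = s j (s i (s j v))"
  by (cases "i = j") (auto simp: simple_refl_eq pairing_upd diag fun_eq_iff)

lemma weyl_Nil [simp]: "W [] v = v"
  and weyl_Cons [simp]: "W (x # xs) v = s x (W xs v)"
  by (simp_all add: weyl_prod_def)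

lemma weyl_append: "W (xs @ ys) v = W xs (W ys v)"
  by (induction xs) auto

lemma weyl_refl_commute:
  assumes "y \<in> I" "set xs \<subseteq> I" "\<And>x. x \<in> set xs \<Longrightarrow> A x y = 0 \<and> A y x = 0"
  shows "s y (W xs v) = W xs (s y v)"
  using assms(2,3)
proof (induction xs)
  case (Cons x xs)
  then show ?case using refl_commute[of y x "W xs v"] assms(1) by auto
qed simp

lemma weyl_commute:
  assumes "set xs \<subseteq> I" "set ys \<subseteq> I" "\<And>x y. x \<in> set xs \<Longrightarrow> y \<in> set ys \<Longrightarrow> A x y = 0 \<and> A y x = 0"
  shows "W xs (W ys v) = W ys (W xs v)"
  using assms
proof (induction ys)
  case (Cons y ys)
  then show ?case using weyl_refl_commute[of y xs "W ys v"] by auto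
qed simp

lemma weyl_filter:
  assumes "set xs \<subseteq> I" "\<And>x y. x \<in> I \<Longrightarrow> y \<in> I \<Longrightarrow> P x \<Longrightarrow> \<not> P y \<Longrightarrow> A x y = 0 \<and> A y x = 0"
  shows "W xs v = W (filter P xs) (W (filter (\<lambda>x. \<not> P x) xs) v)"
  using assms(1)
proof (induction xs)
  case (Cons x xs)
  show ?case
  proof (cases "P x")
    case False
    then have "s x (W (filter P xs) w) = W (filter P xs) (s x w)" for w
      using Cons.prems assms(2) by (intro weyl_refl_commute) auto
    then show ?thesis using Cons False by auto
  qed (use Cons in auto)
qed simp

text \<open>For a Coxeter element \<open>w = s\<^sub>1 \<cdots> s\<^sub>r\<close> of type \<open>A\<^sub>r\<close> one has \<open>w s\<^sub>k = s\<^sub>k\<^sub>+\<^sub>1 w\<close>, whence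
  \<open>w\<^sup>2 = (s\<^sub>2 \<cdots> s\<^sub>r) (s\<^sub>1 \<cdots> s\<^sub>r\<^sub>-\<^sub>1)\<close>.\<close>

lemma weyl_linear_chain_square:
  assumes "linear_chain A xs" "set xs \<subseteq> I" "xs \<noteq> []"
  shows "W xs (W xs v) = W (tl xs) (W (butlast xs) v)"
  using assms
proof (induction xs arbitrary: v rule: induct_list012)
  case (2 x)
  then show ?case by (simp add: refl_involution)
next
  case (3 x y zs)
  have comm: "s x (W zs w) = W zs (s x w)" for w
    using 3 by (intro weyl_refl_commute) auto
  \<comment> \<open>The second \<open>s x\<close> passes \<open>zs\<close>. The braid relation then
    exposes the square of the product over \<open>y # zs\<close>, ready for the induction
    hypothesis.\<close>
  have "W (x # y # zs) (W (x # y # zs) v) = s x (s y (s x (W zs (s y (W zs v)))))"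
    by (simp flip: comm)
  also have "\<dots> = s y (s x (s y (W zs (s y (W zs v)))))"
    using 3 by (intro refl_braid) auto
  also have "s y (W zs (s y (W zs v))) = W zs (W (butlast (y # zs)) v)"
    using 3 by simp
  also have "s y (s x (W zs (W (butlast (y # zs)) v))) = W (y # zs) (W (butlast (x # y # zs)) v)"
    using comm by simp
  finally show ?case by simp
qed simp

text \<open>The isolated letters \<open>xs\<close> commute with the remaining letters
  \<open>ys\<close>, so the element is a product of the squares of the two parts. By
  \<open>weyl_linear_chain_square\<close> the first square has an expression with two letters fewer
  than \<open>xs @ xs\<close>.\<close>

lemma linear_chain_not_reduced:
  assumes i0: "set i0 \<subseteq> I" and xs: "xs \<noteq> []" "linear_chain A xs" "xs = filter (\<lambda>x. x \<in> set xs) i0"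
    and isolated: "\<And>x y. x \<in> set xs \<Longrightarrow> y \<in> I - set xs \<Longrightarrow> A x y = 0 \<and> A y x = 0"
  shows "\<not> reduced_word I A (i0 @ i0)"
proof
  assume red: "reduced_word I A (i0 @ i0)"
  define ys where "ys = filter (\<lambda>x. x \<notin> set xs) i0"
  have xsI: "set xs \<subseteq> I" using i0 xs(3) by (metis filter_is_subset subset_trans)
  have ysI: "set ys \<subseteq> I" using i0 by (auto simp: ys_def)
  have "W i0 v = W (filter (\<lambda>x. x \<in> set xs) i0) (W ys v)" for v
    unfolding ys_def by (rule weyl_filter[OF i0]) (use isolated in auto)
  then have split: "W i0 v = W xs (W ys v)" for v
    using xs(3) by simp
  have comm: "W ys (W xs v) = W xs (W ys v)" for v
    by (rule weyl_commute[OF ysI xsI]) (use isolated ysI in \<open>auto simp: ys_def\<close>)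
  have "W (i0 @ i0) v = W (tl xs @ butlast xs @ ys @ ys) v" for v
    by (simp add: weyl_append split comm weyl_linear_chain_square[OF xs(2) xsI xs(1)])
  then have eq: "W (tl xs @ butlast xs @ ys @ ys) = W (i0 @ i0)" by auto
  have sub: "set (tl xs @ butlast xs @ ys @ ys) \<subseteq> I"
    using xsI ysI by (auto dest: list.set_sel(2) in_set_butlastD) (metis list.sel(2) list.set_sel(2) subset_iff)
  have "weyl_length I A (W (i0 @ i0)) \<le> length (tl xs @ butlast xs @ ys @ ys)"
    unfolding weyl_length_def by (rule Least_le) (use eq sub in blast)
  moreover have "length i0 = length xs + length ys"
    using sum_length_filter_compl[of "\<lambda>x. x \<in> set xs" i0] xs(3) by (simp add: ys_def)
  moreover obtain r where "length xs = Suc r" using xs(1) by (cases xs) auto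
  ultimately show False using red by (simp add: reduced_word_def)
qed

end

section \<open>Triangularity and bijectivity of \<open>phi\<close>\<close>

lemma phi_basis_outside: "p \<notin> {1..length ws} \<Longrightarrow> phi_basis A ws k p = 0"
  by (auto simp: phi_basis_def eps_def intro!: sum.neutral)

lemma prev_pos_less: "k \<ge> 1 \<Longrightarrow> prev_pos ws k < k"
  unfolding prev_pos_def by (subst Max_less_iff) auto

lemma phi_basis_above:
  assumes "k \<in> {1..length ws}" "k \<le> p"
  shows "phi_basis A ws k p = (if p = k then - 1 else 0)"
proof -
  have "(\<Sum>l \<in> {l \<in> {1..length ws}. l < k \<and> k < next_pos ws l}. A (letter ws l) (letter ws k) * eps (length ws) l p) = 0"
    using assms by (intro sum.neutral) (auto simp: eps_def)
  then show ?thesis using assms prev_pos_less[of k ws] by (auto simp: phi_basis_def eps_def)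
qed

lemma phi_add: "phi A ws (\<lambda>p. a p + b p) = (\<lambda>p. phi A ws a p + phi A ws b p)"
  by (simp add: phi_def distrib_right sum.distrib)

lemma phi_scale: "phi A ws (\<lambda>p. x * a p) = (\<lambda>p. x * phi A ws a p)"
  by (simp add: phi_def sum_distrib_left mult.assoc)

lemma phi_sum: "phi A ws (\<lambda>p. \<Sum>j\<in>S. a j p) = (\<lambda>p. \<Sum>j\<in>S. phi A ws (a j) p)"
  unfolding phi_def sum_distrib_right by (subst sum.swap) simp

lemma phi_eps: "k \<in> {1..length ws} \<Longrightarrow> phi A ws (eps (length ws) k) = phi_basis A ws k"
proof (rule ext)
  fix p assume k: "k \<in> {1..length ws}"
  have "phi A ws (eps (length ws) k) p = (\<Sum>l\<in>{1..length ws}. if l = k then phi_basis A ws l p else 0)"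
    unfolding phi_def eps_def using k by (intro sum.cong) auto
  then show "phi A ws (eps (length ws) k) p = phi_basis A ws k p" using k by simp
qed

lemma eps_zlattice: "eps n k \<in> zlattice n"
  by (auto simp: zlattice_def eps_def)

text \<open>At the largest position where \<open>a\<close> and \<open>b\<close> differ, only the
  diagonal entry \<open>- 1\<close> contributes to the difference of the images.\<close>

lemma phi_inj:
  assumes "a \<in> zlattice (length ws)" "b \<in> zlattice (length ws)" "phi A ws a = phi A ws b"
  shows "a = b"
proof (rule ccontr)
  assume "a \<noteq> b"
  define K where "K = {k. a k \<noteq> b k}"
  have K: "K \<subseteq> {1..length ws}" "K \<noteq> {}" "finite K"
  proof -
    show "K \<subseteq> {1..length ws}" using assms(1,2) by (force simp: K_def zlattice_def)
    then show "finite K" by (rule finite_subset) simp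
    show "K \<noteq> {}" using \<open>a \<noteq> b\<close> by (auto simp: K_def)
  qed
  define k where "k = Max K"
  have k: "k \<in> K" using K by (simp add: k_def)
  have "(\<Sum>l=1..length ws. (a l - b l) * phi_basis A ws l k) =
      (\<Sum>l=1..length ws. if l = k then - (a k - b k) else 0)"
  proof (intro sum.cong refl)
    fix l assume l: "l \<in> {1..length ws}"
    show "(a l - b l) * phi_basis A ws l k = (if l = k then - (a k - b k) else 0)"
    proof (cases "l \<le> k")
      case True
      then show ?thesis using l by (auto simp: phi_basis_above)
    next
      case False
      then have "l \<notin> K" using Max_ge[OF K(3), of l] by (auto simp: k_def)
      then show ?thesis using False by (auto simp: K_def)
    qed
  qed
  also have "\<dots> = - (a k - b k)" using k K(1) by (subst sum.delta) auto
  finally have "phi A ws a k - phi A ws b k = - (a k - b k)"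
    by (simp add: phi_def left_diff_distrib sum_subtractf)
  then show False using assms(3) k by (simp add: K_def)
qed

text \<open>Elimination from the top coordinate downwards; the pivots are \<open>- 1\<close>, so the
  solution stays integral.\<close>

lemma phi_surj_aux:
  assumes "s \<le> length ws" "y \<in> zlattice s"
  shows "\<exists>a\<in>zlattice (length ws). phi A ws a = y"
  using assms
proof (induction s arbitrary: y)
  case 0
  then have "y = (\<lambda>p. 0)" by (auto simp: zlattice_def)
  then show ?case by (intro bexI[of _ "\<lambda>p. 0"]) (auto simp: zlattice_def phi_def)
next
  case (Suc s)
  \<comment> \<open>The pivot at \<open>Suc s\<close> is \<open>- 1\<close>, so adding this multiple
    clears that coordinate.\<close>
  define y' where "y' = (\<lambda>p. y p + y (Suc s) * phi_basis A ws (Suc s) p)"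
  have "y' p = 0" if "p \<notin> {1..s}" for p
  proof (cases "p \<in> {1..length ws}")
    case True
    then have "Suc s \<le> p" using that by auto
    then show ?thesis using Suc.prems by (auto simp: y'_def phi_basis_above zlattice_def)
  next
    case False
    then have "y p = 0" using Suc.prems by (auto simp: zlattice_def)
    then show ?thesis using False by (simp add: y'_def phi_basis_outside)
  qed
  then have "y' \<in> zlattice s" by (auto simp: zlattice_def)
  then obtain a where a: "a \<in> zlattice (length ws)" "phi A ws a = y'"
    using Suc.IH[of y'] Suc.prems by auto
  let ?a = "\<lambda>p. a p + (- y (Suc s)) * eps (length ws) (Suc s) p"
  have "phi A ws ?a = y"
    using Suc.prems phi_eps[of "Suc s" ws A]
    unfolding phi_add phi_scale by (auto simp: a(2) y'_def)
  moreover have "?a \<in> zlattice (length ws)"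
    using a(1) eps_zlattice[of "length ws" "Suc s"] by (auto simp: zlattice_def)
  ultimately show ?case by blast
qed

lemma phi_inv_works:
  assumes "y \<in> zlattice (length ws)"
  shows "phi_inv A ws y \<in> zlattice (length ws)" "phi A ws (phi_inv A ws y) = y"
proof -
  have "y \<in> phi A ws ` zlattice (length ws)"
    using phi_surj_aux[OF order_refl assms] by (metis imageI)
  then show "phi_inv A ws y \<in> zlattice (length ws)" "phi A ws (phi_inv A ws y) = y"
    unfolding phi_inv_def by (rule inv_into_into, rule f_inv_into_f)
qed

section \<open>The doubled word\<close>

locale doubled_word =
  fixes i0 :: "'i list"
  assumes dist: "distinct i0"
begin

abbreviation "n \<equiv> length i0"
abbreviation "ws \<equiv> i0 @ i0"

lemma letter_left: "k \<in> {1..n} \<Longrightarrow> letter ws k = i0 ! (k - 1)"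
  by (auto simp: letter_def nth_append)

lemma letter_right: "k \<in> {1..n} \<Longrightarrow> letter ws (n + k) = letter ws k"
  by (auto simp: letter_def nth_append)

lemma letter_inj: "k \<in> {1..n} \<Longrightarrow> l \<in> {1..n} \<Longrightarrow> letter ws k = letter ws l \<longleftrightarrow> k = l"
  using dist by (auto simp: letter_left nth_eq_iff_index_eq)

lemma position_cases:
  assumes "k \<in> {1..length ws}"
  obtains (left) "k \<in> {1..n}" | (right) l where "k = n + l" "l \<in> {1..n}"
proof (cases "k \<le> n")
  case True
  then show thesis using assms that(1) by auto
next
  case False
  then show thesis using assms by (intro that(2)[of "k - n"]) auto
qed

lemma letter_eq_iff:
  assumes "p \<in> {1..n}" "k \<in> {1..length ws}"
  shows "letter ws k = letter ws p \<longleftrightarrow> k = p \<or> k = n + p"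
  using assms(2)
proof (cases rule: position_cases)
  case left
  then show ?thesis using assms letter_inj by auto
next
  case (right l)
  then show ?thesis using assms letter_inj[of l p] letter_right[of l] by auto
qed

lemma occurrences: "p \<in> {1..n} \<Longrightarrow> {k \<in> {1..length ws}. letter ws k = letter ws p} = {p, n + p}"
  using letter_eq_iff by auto

lemma prev_pos_left:
  assumes p: "p \<in> {1..n}"
  shows "prev_pos ws p = 0"
proof -
  have "{l \<in> {1..length ws}. l < p \<and> letter ws l = letter ws p} = {}"
    using letter_eq_iff[OF p] by auto
  then show ?thesis unfolding prev_pos_def by (simp only:) simp
qed

lemma prev_pos_right:
  assumes p: "p \<in> {1..n}"
  shows "prev_pos ws (n + p) = p"
proof -
  have "{l \<in> {1..length ws}. l < n + p \<and> letter ws l = letter ws p} = {p}"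
    using letter_eq_iff[OF p] p by auto
  then show ?thesis unfolding prev_pos_def letter_right[OF p] by (simp only:) simp
qed

lemma next_pos_left:
  assumes p: "p \<in> {1..n}"
  shows "next_pos ws p = n + p"
proof -
  have "{l \<in> {1..length ws}. p < l \<and> letter ws l = letter ws p} = {n + p}"
    using letter_eq_iff[OF p] p by auto
  then show ?thesis unfolding next_pos_def using p by (simp only:) simp
qed

lemma next_pos_right:
  assumes p: "p \<in> {1..n}"
  shows "next_pos ws (n + p) = 2 * n + 1"
proof -
  have "{l \<in> {1..length ws}. n + p < l \<and> letter ws l = letter ws p} = {}"
    using letter_eq_iff[OF p] by auto
  then show ?thesis unfolding next_pos_def letter_right[OF p] by (simp only:) simp
qed

text \<open>\<open>phi_basis\<close> gives the columns of the matrix of \<open>phi\<close>; this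
  collects its row at \<open>p\<close>.\<close>

lemma phi_eq:
  assumes "p \<in> {1..length ws}"
  shows "phi A ws a p = - a p - (\<Sum>k\<in>{k\<in>{1..length ws}. prev_pos ws k = p}. a k)
    - (\<Sum>k\<in>{k\<in>{1..length ws}. p < k \<and> k < next_pos ws p}. A (letter ws p) (letter ws k) * a k)"
proof -
  have basis: "phi_basis A ws k p = - (if k = p then 1 else 0) - (if prev_pos ws k = p then 1 else 0)
      - (if p < k \<and> k < next_pos ws p then A (letter ws p) (letter ws k) else 0)" if "k \<in> {1..length ws}" for k
  proof -
    have "(\<Sum>l \<in> {l \<in> {1..length ws}. l < k \<and> k < next_pos ws l}. A (letter ws l) (letter ws k) * eps (length ws) l p)
      = (\<Sum>l \<in> {l \<in> {1..length ws}. l < k \<and> k < next_pos ws l}. if l = p then A (letter ws l) (letter ws k) else 0)"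
      by (intro sum.cong) (auto simp: eps_def)
    also have "\<dots> = (if p < k \<and> k < next_pos ws p then A (letter ws p) (letter ws k) else 0)"
      using assms by (subst sum.delta) auto
    finally show ?thesis unfolding phi_basis_def using assms that by (auto simp: eps_def)
  qed
  have "phi A ws a p = (\<Sum>k=1..length ws. - (if k = p then a k else 0) - (if prev_pos ws k = p then a k else 0)
      - (if p < k \<and> k < next_pos ws p then A (letter ws p) (letter ws k) * a k else 0))"
    unfolding phi_def by (intro sum.cong refl) (auto simp: basis algebra_simps)
  then show ?thesis
    unfolding sum.inter_filter[OF finite_atLeastAtMost]
    using assms by (simp add: sum_subtractf sum_negf)
qed

abbreviation "BB A p k \<equiv> A (letter ws p) (letter ws k)"

lemma sum_between:
  assumes "p \<in> {1..n}"
  shows "(\<Sum>k\<in>{p<..<n + p}. f k) = (\<Sum>k\<in>{p<..n}. f k) + (\<Sum>k\<in>{1..<p}. f (n + k))"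
proof -
  have "{p<..<n + p} = {p<..n} \<union> (+) n ` {1..<p}"
  proof (intro equalityI subsetI)
    fix k assume k: "k \<in> {p<..<n + p}"
    show "k \<in> {p<..n} \<union> (+) n ` {1..<p}"
    proof (cases "k \<le> n")
      case False
      then have "k = n + (k - n)" "k - n \<in> {1..<p}" using k by auto
      then show ?thesis by blast
    qed (use k in auto)
  qed (use assms in auto)
  moreover have "(\<Sum>k\<in>(+) n ` {1..<p}. f k) = (\<Sum>k\<in>{1..<p}. f (n + k))"
    by (subst sum.reindex) auto
  moreover have "{p<..n} \<inter> (+) n ` {1..<p} = {}" by auto
  ultimately show ?thesis by (simp add: sum.union_disjoint)
qed

text \<open>Describes the gap through the two occurrences of a letter and the positions between
  them, the form in which it meets both \<open>phi\<close> and the commutation exponents.\<close>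

lemma gap_eq_between:
  assumes "p \<in> {1..n}"
  shows "gap n (BB A) a p = a p + a (n + p) + (\<Sum>k\<in>{p<..<n + p}. BB A p k * a k)"
proof -
  have "(\<Sum>k\<in>{1..<p}. BB A p (n + k) * a (n + k)) = (\<Sum>k\<in>{1..<p}. BB A p k * a (n + k))"
    using assms by (intro sum.cong refl) (simp add: letter_right)
  then show ?thesis unfolding gap_def sum_between[OF assms] by simp
qed

lemma phi_left:
  assumes p: "p \<in> {1..n}"
  shows "phi A ws a p = - gap n (BB A) a p"
proof -
  have "{k\<in>{1..length ws}. prev_pos ws k = p} = {n + p}"
  proof (intro equalityI subsetI)
    fix k assume k: "k \<in> {k\<in>{1..length ws}. prev_pos ws k = p}"
    then have "k \<in> {1..length ws}" by simp
    then show "k \<in> {n + p}"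
      by (cases rule: position_cases) (use k p prev_pos_left prev_pos_right in auto)
  qed (use p prev_pos_right in auto)
  moreover have "{k\<in>{1..length ws}. p < k \<and> k < next_pos ws p} = {p<..<n + p}"
    using p by (auto simp: next_pos_left)
  ultimately show ?thesis
    using p by (subst phi_eq) (auto simp: gap_eq_between)
qed

lemma phi_right:
  assumes p: "p \<in> {1..n}"
  shows "phi A ws a (n + p) = - frozen_deg n (BB A) a p"
proof -
  have pos: "n + p \<in> {1..length ws}" using p by auto
  have prev: "{k\<in>{1..length ws}. prev_pos ws k = n + p} = {}"
  proof -
    have "prev_pos ws k \<noteq> n + p" if "k \<in> {1..length ws}" for k
      using that by (cases rule: position_cases) (use p prev_pos_left prev_pos_right in auto)
    then show ?thesis by auto
  qed
  \<comment> \<open>The letter does not recur, so \<open>next_pos\<close> has its default value and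
    the range extends to the end of the word.\<close>
  have next_: "{k\<in>{1..length ws}. n + p < k \<and> k < next_pos ws (n + p)} = (+) n ` {p<..n}"
  proof -
    have "k \<in> (+) n ` {p<..n}" if "n + p < k" "k \<le> 2 * n" for k
      using that by (intro image_eqI[of _ _ "k - n"]) auto
    then show ?thesis using p by (auto simp: next_pos_right)
  qed
  have "(\<Sum>k\<in>(+) n ` {p<..n}. BB A (n + p) k * a k) = (\<Sum>k\<in>{p<..n}. BB A p k * a (n + k))"
    using p by (subst sum.reindex) (auto intro!: sum.cong simp: letter_right)
  then show ?thesis unfolding phi_eq[OF pos] prev next_ frozen_deg_def by simp
qed

end

text \<open>Positions outside the interval from \<open>p\<close> to \<open>n + p\<close> contribute
  equally to both exponents. Those strictly inside contribute with opposite signs, hence twice, and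
  each endpoint contributes \<open>c ?j ?j\<close>, which is twice \<open>d ?j\<close>.\<close>

lemma (in feigin) comm_exp_diff:
  assumes ws_eq: "ws = i0 @ i0" and i0: "distinct i0" and p: "p \<in> {1..length i0}"
  shows "comm_exp (length i0 + p) a - comm_exp p a =
    2 * int (d (letter ws p)) * gap (length i0) (\<lambda>p k. A (letter ws p) (letter ws k)) a p"
proof -
  interpret doubled_word i0 by (unfold_locales, rule i0)
  let ?n = "length i0" and ?j = "letter ws p"
  have j: "letter ws (?n + p) = ?j" using letter_right[OF p] ws_eq by simp
  have jI: "?j \<in> I" using p ws_eq by (intro letter_in) auto
  have summand: "(comm_form (?n + p) k - comm_form p k) * a k =
      (if k = p then c ?j ?j * a k else 0) + (if k = ?n + p then c ?j ?j * a k else 0) +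
      (if p < k \<and> k < ?n + p then 2 * (c ?j (letter ws k) * a k) else 0)" if "k \<in> {1..m}" for k
    using that p j c_sym[OF letter_in[OF that] jI] by (auto simp: comm_form_def)
  have jj: "c ?j ?j = 2 * int (d ?j)"
    using cartan jI by (auto simp: symmetrizable_cartan_def csym_def)
  have mid: "{k \<in> {1..m}. p < k \<and> k < ?n + p} = {p<..<?n + p}" using p ws_eq by auto
  have "comm_exp (?n + p) a - comm_exp p a = (\<Sum>k=1..m. (comm_form (?n + p) k - comm_form p k) * a k)"
    by (simp add: comm_exp_def left_diff_distrib sum_subtractf)
  also have "\<dots> = (\<Sum>k=1..m. (if k = p then c ?j ?j * a k else 0) + (if k = ?n + p then c ?j ?j * a k else 0) +
      (if p < k \<and> k < ?n + p then 2 * (c ?j (letter ws k) * a k) else 0))"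
    by (intro sum.cong refl summand)
  also have "\<dots> = c ?j ?j * a p + c ?j ?j * a (?n + p) + (\<Sum>k\<in>{p<..<?n + p}. 2 * (c ?j (letter ws k) * a k))"
    unfolding sum.distrib mid[symmetric] sum.inter_filter[OF finite_atLeastAtMost]
    using p ws_eq by simp
  also have "\<dots> = 2 * int (d ?j) * (a p + a (?n + p) + (\<Sum>k\<in>{p<..<?n + p}. A ?j (letter ws k) * a k))"
    unfolding jj unfolding csym_def by (simp add: distrib_left sum_distrib_left mult.assoc)
  finally show ?thesis using gap_eq_between[OF p, of A a] by (simp add: ws_eq)
qed

section \<open>Realisation of the cluster monomials for the doubled word\<close>

theorem corollary1p2:
  fixes I :: "'i set" and A :: "'i \<Rightarrow> 'i \<Rightarrow> int" and d :: "'i \<Rightarrow> nat"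
    and i0 :: "'i list" and n :: nat
  assumes "symmetrizable_cartan I A d"
    and "n = card I"
    and "distinct i0" and "set i0 = I"
    and "reduced_word I A (i0 @ i0)"
  shows "\<forall>i \<in> {1..n}. \<exists>Xt \<in> carrier (Uplus I A d :: ('i, ('k::field_char_0) qfield) ncpoly set ring).
           \<exists>e :: nat \<Rightarrow> nat.
             Psi I A d (i0 @ i0) Xt =
               cluster_X A d (i0 @ i0) i \<otimes>\<^bsub>torus A d (i0 @ i0)\<^esub>
               oprod (torus A d (i0 @ i0))
                 (\<lambda>j. cluster_C A d (i0 @ i0) n j [^]\<^bsub>torus A d (i0 @ i0)\<^esub> e j) n"
proof
  fix i assume i: "i \<in> {1..n}"
  have n: "n = length i0" using assms(2-4) distinct_card by metis
  let ?ws = "i0 @ i0"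
  let ?B = "\<lambda>p k. A (letter ?ws p) (letter ?ws k)"
  interpret dw: doubled_word i0 by (unfold_locales, rule assms(3))
  interpret feigin "torus_rels A d ?ws :: (tgen, 'k qfield) ncpoly set" I A d ?ws
    by unfold_locales (use assms in auto)
  have len: "length ?ws = 2 * n" using n by simp
  have occ: "{k \<in> {1..length ?ws}. letter ?ws k = letter ?ws p} = {p, n + p}" if "p \<in> {1..n}" for p
    using dw.occurrences that n by simp
  have lI: "letter ?ws p \<in> I" if "p \<in> {1..n}" for p
    using that len by (intro letter_in) auto
  have inj: "letter ?ws p = letter ?ws k \<longleftrightarrow> p = k" if "p \<in> {1..n}" "k \<in> {1..n}" for p k
    using dw.letter_inj that n by simp
  have sig: "sigma (letter ?ws p) = t p + t (n + p)" if "p \<in> {1..n}" for p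
    using occ[OF that] that i by (intro sigma_pair) auto
  have comm_exp_neq: "comm_exp p a \<noteq> comm_exp (n + p) a" if "p \<in> {1..n}" "gap n ?B a p \<noteq> 0" for p a
  proof -
    have "d (letter ?ws p) > 0" using assms(1) lI[OF that(1)] by (auto simp: symmetrizable_cartan_def)
    then show ?thesis using comm_exp_diff[OF refl assms(3), of p a] that n by auto
  qed
  interpret monomial_moves n ?B mono_image
  proof unfold_locales
    fix p k assume pk: "p \<in> {1..n}" "k \<in> {1..n}"
    show "?B p k \<le> 0" if "p \<noteq> k"
      using assms(1) lI pk inj[OF pk] that by (auto simp: symmetrizable_cartan_def)
    show "(?B p k = 0) = (?B k p = 0)"
      using assms(1) lI pk by (auto simp: symmetrizable_cartan_def)
  next
    fix a b assume "mono_image a" "mono_image b"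
    then show "mono_image (\<lambda>k. a k + b k)" by (rule mono_image_add)
  next
    fix k a assume k: "k \<in> {1..n}" "mono_image a" "gap n ?B a k \<noteq> 0"
    have pos: "k \<in> {1..m}" "n + k \<in> {1..m}" using k len by auto
    show "mono_image (\<lambda>l. a l + unitv k l)"
      using mono_image_move[OF pos sig[OF k(1)] comm_exp_neq[OF k(1,3)] k(2)] .
    \<comment> \<open>The same move with the two positions exchanged, so that now the contribution
      of \<open>t k\<close> cancels.\<close>
    show "mono_image (\<lambda>l. a l + unitv (n + k) l)"
      using mono_image_move[OF pos(2,1) _ comm_exp_neq[OF k(1,3), symmetric] k(2)] sig[OF k(1)] by (simp add: add.commute)
  next
    fix k j assume kj: "k \<in> {1..n}" "j \<in> {1..n}" "k < j" "?B k j \<noteq> 0"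
    have "c (letter ?ws k) (letter ?ws j) \<noteq> 0"
      using kj assms(1) lI[OF kj(1)] by (auto simp: csym_def symmetrizable_cartan_def)
    \<comment> \<open>The positions occur in the order \<open>k < j < n + k < n + j\<close>, as
      \<open>mono_image_edge\<close> demands.\<close>
    then show "mono_image (\<lambda>l. unitv j l + unitv (n + k) l)"
      using mono_image_edge[of k j "n + k" "n + j" "letter ?ws k" "letter ?ws j"] sig kj len n
        dw.letter_right by auto
  qed
  have low: "low i"
  proof (rule ccontr)
    \<comment> \<open>Reducedness enters here: a maximal chain would be an isolated component of
      type \<open>A_r\<close>, with its letters in linear order in \<open>i0\<close>.\<close>
    assume "\<not> low i"
    from maximal_chain[OF i this] obtain ks where ks: "ks \<noteq> []" "set ks \<subseteq> {1..n}" "sorted_wrt (<) ks"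
      "linear_chain ?B ks" "\<forall>p\<in>set ks. \<forall>l\<in>{1..n} - set ks. ?B p l = 0" by blast
    interpret weyl_action I A
      by unfold_locales (use assms(1) in \<open>auto simp: symmetrizable_cartan_def\<close>)
    let ?xs = "map (letter ?ws) ks"
    have "linear_chain A (map f ls)" if "linear_chain (\<lambda>p k. A (f p) (f k)) ls" for f :: "nat \<Rightarrow> 'i" and ls
      using that by (induction ls rule: induct_list012) auto
    then have chain: "linear_chain A ?xs" using ks(4) by blast
    \<comment> \<open>A chain is an increasing list of positions; writing \<open>i0\<close> through
      positions identifies its letters with the sublist required by
      \<open>linear_chain_not_reduced\<close>.\<close>
    have i0: "i0 = map (letter ?ws) [1..<Suc n]"
      by (rule nth_equalityI) (auto simp: n letter_def nth_append simp del: upt_Suc)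
    have "filter (\<lambda>k. k \<in> set ks) [1..<Suc n] = ks"
    proof (rule sorted_distinct_set_unique)
      show "set (filter (\<lambda>k. k \<in> set ks) [1..<Suc n]) = set ks"
        using ks(2) by (auto simp del: upt_Suc)
    qed (use ks(3) in \<open>auto simp: strict_sorted_iff sorted_wrt_filter simp del: upt_Suc\<close>)
    moreover have "filter (\<lambda>x. x \<in> set ?xs) i0 = map (letter ?ws) (filter (\<lambda>k. letter ?ws k \<in> set ?xs) [1..<Suc n])"
      by (subst i0) (simp add: filter_map comp_def del: upt_Suc)
    moreover have "filter (\<lambda>k. letter ?ws k \<in> set ?xs) [1..<Suc n] = filter (\<lambda>k. k \<in> set ks) [1..<Suc n]"
      using ks(2) inj by (intro filter_cong refl) (auto simp del: upt_Suc)
    ultimately have filt: "?xs = filter (\<lambda>x. x \<in> set ?xs) i0" by simp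
    have "A x y = 0 \<and> A y x = 0" if x: "x \<in> set ?xs" and y: "y \<in> I - set ?xs" for x y
    proof -
      obtain p where p: "p \<in> set ks" "x = letter ?ws p" using x by auto
      have "set i0 = letter ?ws ` {1..n}"
        using arg_cong[OF i0, of set] by (simp add: atLeastLessThanSuc_atLeastAtMost del: upt_Suc)
      then obtain l where l: "l \<in> {1..n}" "y = letter ?ws l" using y assms(4) by blast
      then have "l \<in> {1..n} - set ks" using y by auto
      then have "A x y = 0" using ks(5) p l by auto
      then show ?thesis using B_zero_sym[of p l] p l ks(2) by auto
    qed
    then have "\<not> reduced_word I A ?ws"
      by (intro linear_chain_not_reduced[OF _ _ chain filt]) (use assms(4) ks(1) in auto)
    then show False using assms(5) by simp
  qed
  from low_target[OF i low] obtain a where a: "mono_image a" "a \<in> zlattice (2 * n)"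
    "\<forall>p\<in>{1..n}. gap n ?B a p = - unitv i p \<and> frozen_deg n ?B a p \<ge> 0" by blast
  define e where "e j = nat (frozen_deg n ?B a j)" for j
  let ?x = "phi_inv A ?ws (eps m i)" and ?y = "\<lambda>j p. - phi_inv A ?ws (eps m (n + j)) p"
  let ?tot = "\<lambda>p. ?x p + (\<Sum>j=1..n. int (e j) * ?y j p)"
  note inv = phi_inv_works[OF eps_zlattice, where ws = ?ws]
  \<comment> \<open>By injectivity it suffices to compare images under \<open>phi\<close>: that of
    \<open>?tot\<close> is the basis vector \<open>i\<close> minus \<open>e j\<close> times the
    basis vectors \<open>n + j\<close>.\<close>
  have "?tot = a"
  proof (rule phi_inj[where ws = ?ws and A = A])
    show "?tot \<in> zlattice m" using inv(1) by (auto simp: zlattice_def intro!: sum.neutral)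
    show "a \<in> zlattice m" unfolding len by (rule a(2))
    show "phi A ?ws ?tot = phi A ?ws a"
    proof (rule ext)
      fix p
      have "?y j = (\<lambda>p. (- 1) * phi_inv A ?ws (eps m (n + j)) p)" for j by simp
      then have "phi A ?ws ?tot p = eps m i p - (\<Sum>j=1..n. int (e j) * eps m (n + j) p)"
        by (simp only: phi_add phi_sum phi_scale inv(2)) (simp add: sum_negf)
      also have "\<dots> = phi A ?ws a p"
      proof (cases "p \<in> {1..m}")
        case False
        then show ?thesis by (auto simp: eps_def phi_def phi_basis_outside intro!: sum.neutral)
      next
        case True
        then show ?thesis
        proof (cases rule: dw.position_cases)
          case left
          then have p: "p \<in> {1..n}" using n by simp
          have "(\<Sum>j=1..n. int (e j) * eps m (n + j) p) = 0"
            using p by (intro sum.neutral) (auto simp: eps_def)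
          then show ?thesis using dw.phi_left[of p A a] p a(3) i len
            by (auto simp: n[symmetric] eps_def)
        next
          case (right l)
          then have l: "l \<in> {1..n}" "p = n + l" using n by auto
          have "(\<Sum>j=1..n. int (e j) * eps m (n + j) p) = (\<Sum>j=1..n. if j = l then int (e j) else 0)"
            using l len by (intro sum.cong) (auto simp: eps_def)
          then show ?thesis using dw.phi_right[of l A a] l a(3) i len
            by (auto simp: n[symmetric] eps_def e_def)
        qed
      qed
      finally show "phi A ?ws ?tot p = phi A ?ws a p" .
    qed
  qed
  then obtain F where F: "F \<in> carrier TA" "scong F (tmonomial a)"
    "tmon A d ?ws ?x \<otimes>\<^bsub>torus A d ?ws\<^esub>
      oprod (torus A d ?ws) (\<lambda>j. tmon A d ?ws (?y j) [^]\<^bsub>torus A d ?ws\<^esub> e j) n = tclass A d ?ws F"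
    using cluster_monomial_eq[where x = ?x and n = n and e = e and y = ?y] by metis
  from mono_image_realize[OF a(1) F(2,1)] obtain Xt where "Xt \<in> carrier U" "Psi I A d ?ws Xt = tclass A d ?ws F"
    by blast
  then show "\<exists>Xt \<in> carrier (Uplus I A d :: ('i, 'k qfield) ncpoly set ring).
           \<exists>e :: nat \<Rightarrow> nat.
             Psi I A d (i0 @ i0) Xt =
               cluster_X A d (i0 @ i0) i \<otimes>\<^bsub>torus A d (i0 @ i0)\<^esub>
               oprod (torus A d (i0 @ i0))
                 (\<lambda>j. cluster_C A d (i0 @ i0) n j [^]\<^bsub>torus A d (i0 @ i0)\<^esub> e j) n"
    using F(3) by (intro bexI[of _ Xt] exI[of _ e]) (simp_all add: cluster_X_def cluster_C_def)
qed

end
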